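(* Let $d\ge2$, let $\alpha\in(0,1]$, and let $(Z_n)_{n\ge0}$ be the Diaconis and Freedman's chain on $\Delta_d$ with weight functions $p_0,\dots,p_d$ and transition operator $P$. Assume that (1) for all $j=0,\dots,d$, the function $p_j$ belongs to $\mathcal H_\alpha(\Delta_d)$; (2) there exists $i\in\{0,\dots,d\}$ such that $\min_{\mathbf{x}\in\Delta_d}p_i(\mathbf{x})>0$. Then there is a unique $P$-invariant Borel probability measure $\nu$ on $\Delta_d$. Furthermore, there exist constants $\kappa>0$ and $\rho\in(0,1)$ such that $$\forall \varphi\in\mathcal H_\alpha(\Delta_d),\ \forall \mathbf{x}\in\Delta_d,\ \forall n\ge 0:\qquad |P^n\varphi(\mathbf{x})-\nu(\varphi)|\le \kappa\,\rho^n\,\|\varphi\|_\alpha .$$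
   Context: $\Delta_d=\{\mathbf{x}\in\mathbb{R}^d: x_i\ge0,\ x_1+\dots+x_d\le 1\}$ is the closed simplex with vertices $\mathbf{e}_0=(0,\dots,0)$ and $\mathbf{e}_i$ the $i$-th standard basis vector, $1\le i\le d$. Given nonnegative continuous weight functions $p_0,\dots,p_d$ on $\Delta_d$ with $\sum_{i=0}^d p_i(\mathbf{x})=1$ for all $\mathbf{x}$, the Diaconis and Freedman's chain $(Z_n)_{n\ge0}$ is the Markov chain on $\Delta_d$ which, when at $\mathbf{x}$, chooses the vertex $\mathbf{e}_i$ with probability $p_i(\mathbf{x})$ and then moves to $t\mathbf{x}+(1-t)\mathbf{e}_i$ with $t$ uniform on $(0,1)$. Its transition operator is $$Pf(\mathbf{x})=\sum_{i=0}^d p_i(\mathbf{x})\int_0^1 f(t\mathbf{x}+(1-t)\mathbf{e}_i)\,dt$$ for bounded measurable $f:\Delta_d\to\mathbb{C}$. A Borel probability measure $\nu$ is $P$-invariant if $\nu(Pf)=\nu(f)$ for all bounded measurable $f$, where $\nu(f)=\int f\,d\nu$. For $0<\alpha\le1$, $\mathcal H_\alpha(\Delta_d)$ is the space of $\alpha$-Hölder continuous functions $f:\Delta_d\to\mathbb{C}$, with norm $\|f\|_\alpha=\|f\|_\infty+m_\alpha(f)$, $m_\alpha(f)=\sup_{\mathbf{x}\ne\mathbf{y}}\frac{|f(\mathbf{x})-f(\mathbf{y})|}{|\mathbf{x}-\mathbf{y}|^\alpha}$. *)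

theory Defs
  imports "HOL-Probability.Probability"
begin

text \<open>The dimension \<open>d\<close> is \<open>CARD('d)\<close>. A function on the simplex is a total function on
  \<open>real ^ 'd\<close> of which only the values on the simplex matter.\<close>

definition std_simplex :: "(real ^ 'd::finite) set" where
  "std_simplex = {x. (\<forall>i. 0 \<le> x $ i) \<and> (\<Sum>i\<in>UNIV. x $ i) \<le> 1}"

text \<open>The \<open>d + 1\<close> indices \<open>0, 1, \<dots>, d\<close> are the elements of \<open>'d option\<close>, with \<open>None\<close> in the
  role of \<open>0\<close>.\<close>

definition vertex :: "'d::finite option \<Rightarrow> real ^ 'd" where
  "vertex j = (case j of None \<Rightarrow> 0 | Some i \<Rightarrow> axis i 1)"

definition weight_functions :: "('d::finite option \<Rightarrow> real ^ 'd \<Rightarrow> real) \<Rightarrow> bool" where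
  "weight_functions p \<longleftrightarrow>
     (\<forall>j. continuous_on std_simplex (p j)) \<and>
     (\<forall>j. \<forall>x\<in>std_simplex. 0 \<le> p j x) \<and>
     (\<forall>x\<in>std_simplex. (\<Sum>j\<in>UNIV. p j x) = 1)"

text \<open>For \<open>x\<close> in the simplex, the value at \<open>x\<close> depends only on the values of \<open>f\<close> on the simplex,
  so the powers of the operator on functions on the simplex are the powers of this one.\<close>

definition transition_op ::
  "('d::finite option \<Rightarrow> real ^ 'd \<Rightarrow> real) \<Rightarrow> (real ^ 'd \<Rightarrow> complex) \<Rightarrow> real ^ 'd \<Rightarrow> complex" where
  "transition_op p f x =
     (\<Sum>j\<in>UNIV. complex_of_real (p j x) *
        (LINT t:{0..1}|lborel. f (t *\<^sub>R x + (1 - t) *\<^sub>R vertex j)))"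

definition borel_prob_on_simplex :: "(real ^ 'd::finite) measure \<Rightarrow> bool" where
  "borel_prob_on_simplex \<nu> \<longleftrightarrow>
     prob_space \<nu> \<and> sets \<nu> = sets (restrict_space borel std_simplex)"

definition invariant_measure ::
  "('d::finite option \<Rightarrow> real ^ 'd \<Rightarrow> real) \<Rightarrow> (real ^ 'd) measure \<Rightarrow> bool" where
  "invariant_measure p \<nu> \<longleftrightarrow>
     (\<forall>f :: real ^ 'd \<Rightarrow> complex.
        f \<in> borel_measurable (restrict_space borel std_simplex) \<longrightarrow> bounded (f ` std_simplex) \<longrightarrow>
        (LINT x|\<nu>. transition_op p f x) = (LINT x|\<nu>. f x))"

text \<open>The weights are real-valued while the test functions are complex-valued, hence the
  general codomain.\<close>

definition holder_on ::
  "real \<Rightarrow> 'a::real_normed_vector set \<Rightarrow> ('a \<Rightarrow> 'b::real_normed_vector) \<Rightarrow> bool" where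
  "holder_on \<alpha> S f \<longleftrightarrow>
     (\<exists>C. \<forall>x\<in>S. \<forall>y\<in>S. norm (f x - f y) \<le> C * norm (x - y) powr \<alpha>)"

text \<open>The suprema are real-valued; they are genuine when \<open>S\<close> is bounded with at least two points
  and \<open>holder_on \<alpha> S f\<close> holds with \<open>\<alpha> > 0\<close>.\<close>

definition holder_seminorm ::
  "real \<Rightarrow> 'a::real_normed_vector set \<Rightarrow> ('a \<Rightarrow> 'b::real_normed_vector) \<Rightarrow> real" where
  "holder_seminorm \<alpha> S f =
     (SUP (x, y)\<in>{(x, y). x \<in> S \<and> y \<in> S \<and> x \<noteq> y}. norm (f x - f y) / norm (x - y) powr \<alpha>)"

definition holder_norm ::
  "real \<Rightarrow> 'a::real_normed_vector set \<Rightarrow> ('a \<Rightarrow> 'b::real_normed_vector) \<Rightarrow> real" where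
  "holder_norm \<alpha> S f = (SUP x\<in>S. norm (f x)) + holder_seminorm \<alpha> S f"

end

theory Submission
  imports Defs
begin

text \<open>
  Let \<open>d (x, y) = min 1 (K * norm (x - y) powr \<alpha>)\<close>. The whole proof rests on one fact: for \<open>K\<close>
  large, one step of the chain multiplies Lipschitz constants with respect to \<open>d\<close> by a factor
  \<open>\<rho> < 1\<close> (\<open>transition_op_contracts\<close>). To see this, run two copies of the chain from \<open>x\<close> and
  \<open>y\<close> with the same \<open>t\<close>, and let them choose the same vertex as often as possible.

  \<^item> If \<open>d (x, y) < 1\<close>, the copies choose different vertices with probability at most
    \<open>C * norm (x - y) powr \<alpha> = (C / K) * d (x, y)\<close>, because the weights are Hoelder; the distance
    after such a step is still at most \<open>1\<close>. Otherwise their difference is multiplied by \<open>t\<close>, and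
    \<open>t powr \<alpha>\<close> has mean \<open>1 / (1 + \<alpha>)\<close>. The mean distance after the step is therefore at most
    \<open>(1 / (1 + \<alpha>) + C / K) * d (x, y)\<close>, and a large \<open>K\<close> makes the factor smaller than \<open>1\<close>.
  \<^item> If \<open>d (x, y) = 1\<close>, the copies choose the vertex with the weight bounded below together with
    probability at least \<open>\<delta> > 0\<close>, and then \<open>t\<close> is, with positive probability, so small that they
    end up at distance less than \<open>1\<close>.

  Truncating the metric thus replaces the spectral theory of quasi-compact operators. As the
  powers of the operator make test functions nearly constant at a geometric rate, the rate of
  convergence and the uniqueness of the invariant measure follow by integrating
  \<open>f x - f y\<close> over \<open>y\<close>, and because such test functions determine a measure
  (\<open>measure_eqI_lipschitz\<close>).

  It remains to find a measure to which the laws of the chain converge. These laws live on a compact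
  subset of \<open>real ^ 'd\<close>, and \<open>convergent_subsequence_of_measures\<close> reduces the compactness of the
  set of such laws to Helly's selection theorem on the real line: a space-filling curve with a
  Borel section transports laws to the unit interval, and the continuity of the curve transports
  weak limits back. The limit along a subsequence is enough, by the contraction.
\<close>

section \<open>The simplex\<close>

lemma vertex_in_simplex: "vertex j \<in> std_simplex"
  by (cases j) (auto simp: vertex_def std_simplex_def axis_def)

lemma simplex_coordinate_le_1:
  assumes "x \<in> std_simplex" shows "x $ i \<le> 1"
proof -
  have "x $ i \<le> (\<Sum>i\<in>UNIV. x $ i)"
    using assms by (intro member_le_sum) (auto simp: std_simplex_def)
  then show ?thesis using assms by (auto simp: std_simplex_def)
qed

lemma simplex_norm_le_1:
  assumes "x \<in> std_simplex" shows "norm x \<le> 1"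
proof -
  have "norm x \<le> (\<Sum>i\<in>UNIV. \<bar>x $ i\<bar>)" by (rule norm_le_l1_cart)
  also have "\<dots> = (\<Sum>i\<in>UNIV. x $ i)"
    using assms by (intro sum.cong) (auto simp: std_simplex_def)
  finally show ?thesis using assms by (auto simp: std_simplex_def)
qed

lemma simplex_diameter:
  assumes "x \<in> std_simplex" "y \<in> std_simplex" shows "norm (x - y) \<le> 2"
  using norm_triangle_ineq4[of x y] simplex_norm_le_1[OF assms(1)] simplex_norm_le_1[OF assms(2)]
  by linarith

lemma convex_simplex: "convex std_simplex"
proof (rule convexI)
  fix x y :: "real ^ 'd" and u v :: real
  assume *: "x \<in> std_simplex" "y \<in> std_simplex" "0 \<le> u" "0 \<le> v" "u + v = 1"
  have "(\<Sum>i\<in>UNIV. (u *\<^sub>R x + v *\<^sub>R y) $ i) = u * (\<Sum>i\<in>UNIV. x $ i) + v * (\<Sum>i\<in>UNIV. y $ i)"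
    by (simp add: sum.distrib sum_distrib_left)
  also have "\<dots> \<le> 1"
    using * by (intro convex_bound_le) (auto simp: std_simplex_def)
  finally show "u *\<^sub>R x + v *\<^sub>R y \<in> std_simplex"
    using * by (auto simp: std_simplex_def)
qed

lemma closed_simplex: "closed (std_simplex :: (real ^ 'd::finite) set)"
  unfolding std_simplex_def
  by (intro closed_Collect_conj closed_Collect_all closed_Collect_le continuous_intros)

lemma simplex_sets [measurable]: "std_simplex \<in> sets borel"
  by (rule borel_closed[OF closed_simplex])

lemma compact_simplex: "compact (std_simplex :: (real ^ 'd::finite) set)"
  using closed_simplex simplex_norm_le_1 by (auto simp: compact_eq_bounded_closed bounded_iff)

lemma move_in_simplex:
  assumes "x \<in> std_simplex" "0 \<le> t" "t \<le> 1"
  shows "t *\<^sub>R x + (1 - t) *\<^sub>R vertex j \<in> std_simplex"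
  using assms convexD[OF convex_simplex assms(1) vertex_in_simplex] by auto

section \<open>Moving towards a random vertex\<close>

definition edge_average ::
  "(real ^ 'd::finite \<Rightarrow> complex) \<Rightarrow> 'd option \<Rightarrow> real ^ 'd \<Rightarrow> complex" where
  "edge_average f j x = (LINT t:{0..1}|lborel. f (t *\<^sub>R x + (1 - t) *\<^sub>R vertex j))"

lemma transition_op_eq_edge_average:
  "transition_op p f x = (\<Sum>j\<in>UNIV. complex_of_real (p j x) * edge_average f j x)"
  by (simp add: transition_op_def edge_average_def)

lemma continuous_along_edge:
  assumes "continuous_on std_simplex f" "x \<in> std_simplex"
  shows "continuous_on {0..1} (\<lambda>t. f (t *\<^sub>R x + (1 - t) *\<^sub>R vertex j))"
  by (rule continuous_on_compose2[OF assms(1)])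
     (use assms(2) move_in_simplex in \<open>auto intro!: continuous_intros\<close>)

lemma edge_average_eq_integral:
  assumes "continuous_on std_simplex f" "x \<in> std_simplex"
  shows "edge_average f j x = integral {0..1} (\<lambda>t. f (t *\<^sub>R x + (1 - t) *\<^sub>R vertex j))"
  unfolding edge_average_def
  by (rule set_borel_integral_eq_integral borel_integrable_atLeastAtMost'
      continuous_along_edge assms)+

lemma edge_average_diff_le:
  assumes f: "continuous_on std_simplex f" and x: "x \<in> std_simplex" and y: "y \<in> std_simplex"
    and g: "g integrable_on {0..1}"
    and le: "\<And>t. 0 \<le> t \<Longrightarrow> t \<le> 1 \<Longrightarrow>
      norm (f (t *\<^sub>R x + (1 - t) *\<^sub>R vertex j) - f (t *\<^sub>R y + (1 - t) *\<^sub>R vertex k)) \<le> g t"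
  shows "norm (edge_average f j x - edge_average f k y) \<le> integral {0..1} g"
proof -
  note int = integrable_continuous_interval[OF continuous_along_edge[OF f]]
  have "edge_average f j x - edge_average f k y = integral {0..1}
      (\<lambda>t. f (t *\<^sub>R x + (1 - t) *\<^sub>R vertex j) - f (t *\<^sub>R y + (1 - t) *\<^sub>R vertex k))"
    using f x y by (simp add: edge_average_eq_integral integral_diff int)
  also have "norm \<dots> \<le> integral {0..1} g"
    using le by (intro integral_norm_bound_integral integrable_diff int x y g) auto
  finally show ?thesis .
qed

text \<open>The right-hand side is what the maximal coupling of \<open>a\<close> and \<open>b\<close> gives: they share the mass
  \<open>min (a j) (b j)\<close> at \<open>j\<close>, and only the rest has to be matched across different indices, where
  nothing better than the bound \<open>L\<close> is known.\<close>

lemma coupled_sum_diff_le: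
  fixes F G :: "'j \<Rightarrow> complex" and a b :: "'j \<Rightarrow> real"
  assumes "finite J"
    and a: "\<And>j. j \<in> J \<Longrightarrow> 0 \<le> a j" "sum a J = 1"
    and b: "\<And>j. j \<in> J \<Longrightarrow> 0 \<le> b j" "sum b J = 1"
    and L: "\<And>j k. j \<in> J \<Longrightarrow> k \<in> J \<Longrightarrow> norm (F j - G k) \<le> L"
  shows "norm ((\<Sum>j\<in>J. of_real (a j) * F j) - (\<Sum>j\<in>J. of_real (b j) * G j))
     \<le> (\<Sum>j\<in>J. min (a j) (b j) * norm (F j - G j)) + (1 - (\<Sum>j\<in>J. min (a j) (b j))) * L"
proof -
  define q where "q j = min (a j) (b j)" for j
  define \<tau> where "\<tau> = 1 - sum q J"
  define a' where "a' j = a j - q j" for j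
  define b' where "b' j = b j - q j" for j
  define R where "R = (\<Sum>j\<in>J. of_real (a' j) * F j) - (\<Sum>j\<in>J. of_real (b' j) * G j)"
  have a'0: "a' j \<ge> 0" and b'0: "b' j \<ge> 0" for j by (auto simp: a'_def b'_def q_def)
  have sa: "sum a' J = \<tau>" and sb: "sum b' J = \<tau>"
    using a b by (auto simp: a'_def b'_def \<tau>_def sum_subtractf)
  have \<tau>0: "\<tau> \<ge> 0" unfolding sa[symmetric] by (intro sum_nonneg a'0)
  have R_le: "norm R \<le> \<tau> * L"
  proof (cases "\<tau> = 0")
    case True
    have "a' j = 0" if "j \<in> J" for j
      using sa True a'0 \<open>finite J\<close> that by (metis sum_nonneg_eq_0_iff)
    moreover have "b' j = 0" if "j \<in> J" for j
      using sb True b'0 \<open>finite J\<close> that by (metis sum_nonneg_eq_0_iff)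
    ultimately show ?thesis using True by (simp add: R_def)
  next
    case False
    \<comment> \<open>Both remainders have mass \<open>\<tau>\<close>, so \<open>\<tau> * R\<close> is a sum over the independent coupling of them.\<close>
    have "(\<Sum>j\<in>J. \<Sum>k\<in>J. of_real (a' j * b' k) * (F j - G k))
        = (\<Sum>j\<in>J. of_real (a' j) * F j * of_real (sum b' J))
          - (\<Sum>j\<in>J. \<Sum>k\<in>J. of_real (a' j) * (of_real (b' k) * G k))"
      by (simp add: algebra_simps sum_subtractf sum_distrib_left of_real_sum)
    also have "(\<Sum>j\<in>J. \<Sum>k\<in>J. of_real (a' j) * (of_real (b' k) * G k))
        = of_real (sum a' J) * (\<Sum>k\<in>J. of_real (b' k) * G k)"
      by (simp add: sum_distrib_left sum_distrib_right of_real_sum) (rule sum.swap)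
    finally have "of_real \<tau> * R = (\<Sum>j\<in>J. \<Sum>k\<in>J. of_real (a' j * b' k) * (F j - G k))"
      by (simp add: sa sb R_def sum_distrib_left sum_distrib_right algebra_simps)
    then have "\<tau> * norm R = norm (\<Sum>j\<in>J. \<Sum>k\<in>J. of_real (a' j * b' k) * (F j - G k))"
      using \<tau>0 by (metis abs_of_nonneg norm_mult norm_of_real)
    also have "\<dots> \<le> (\<Sum>j\<in>J. \<Sum>k\<in>J. a' j * b' k * L)"
      using L a'0 b'0
      by (intro sum_norm_le) (auto simp: norm_mult intro!: mult_left_mono)
    also have "\<dots> = \<tau> * (\<tau> * L)"
      by (simp flip: sum_distrib_left sum_distrib_right add: sa sb mult.assoc)
    finally show ?thesis using False \<tau>0 by simp
  qed
  have "(\<Sum>j\<in>J. of_real (a j) * F j) - (\<Sum>j\<in>J. of_real (b j) * G j)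
     = (\<Sum>j\<in>J. of_real (q j) * (F j - G j)) + R"
    by (simp add: R_def a'_def b'_def sum_subtractf algebra_simps)
  also have "norm \<dots> \<le> norm (\<Sum>j\<in>J. of_real (q j) * (F j - G j)) + norm R"
    by (rule norm_triangle_ineq)
  also have "norm (\<Sum>j\<in>J. of_real (q j) * (F j - G j)) \<le> (\<Sum>j\<in>J. q j * norm (F j - G j))"
    using a(1) b(1) by (intro sum_norm_le) (auto simp: norm_mult q_def)
  finally show ?thesis using R_le by (simp add: q_def \<tau>_def)
qed

section \<open>Contraction in one step\<close>

text \<open>For \<open>0 < \<alpha> \<le> 1\<close> and \<open>K \<ge> 1\<close>, this is Lipschitz continuity for the truncated metric, which is
  one way to control the oscillation and the Hoelder constant of \<open>f\<close> by the single number \<open>L\<close>.\<close>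

definition lipschitz_wrt_trunc ::
  "real \<Rightarrow> real \<Rightarrow> real \<Rightarrow> (real ^ 'd::finite \<Rightarrow> complex) \<Rightarrow> bool" where
  "lipschitz_wrt_trunc \<alpha> K L f \<longleftrightarrow>
     (\<forall>x\<in>std_simplex. \<forall>y\<in>std_simplex. norm (f x - f y) \<le> L * min 1 (K * norm (x - y) powr \<alpha>))"

lemma lipschitz_wrt_truncD:
  assumes "lipschitz_wrt_trunc \<alpha> K L f" "x \<in> std_simplex" "y \<in> std_simplex"
  shows "norm (f x - f y) \<le> L * min 1 (K * norm (x - y) powr \<alpha>)"
  using assms by (auto simp: lipschitz_wrt_trunc_def)

lemma holder_imp_continuous_on:
  fixes f :: "'a::real_normed_vector \<Rightarrow> 'b::real_normed_vector"
  assumes "holder_on \<alpha> S f" "0 < \<alpha>"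
  shows "continuous_on S f"
proof -
  obtain C where C: "\<And>x y. x \<in> S \<Longrightarrow> y \<in> S \<Longrightarrow> norm (f x - f y) \<le> C * norm (x - y) powr \<alpha>"
    using assms(1) by (auto simp: holder_on_def)
  show ?thesis
    unfolding continuous_on_def
  proof
    fix x assume "x \<in> S"
    have "((\<lambda>y. C * norm (y - x) powr \<alpha>) \<longlongrightarrow> C * norm (x - x) powr \<alpha>) (at x within S)"
      using \<open>0 < \<alpha>\<close> by (intro tendsto_intros tendsto_powr') auto
    then have "((\<lambda>y. C * norm (y - x) powr \<alpha>) \<longlongrightarrow> 0) (at x within S)" by simp
    moreover have "\<forall>\<^sub>F y in at x within S. norm (f y - f x) \<le> C * norm (y - x) powr \<alpha>"
      using C \<open>x \<in> S\<close> by (auto simp: eventually_at_filter)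
    ultimately have "((\<lambda>y. f y - f x) \<longlongrightarrow> 0) (at x within S)"
      by (rule Lim_null_comparison[rotated])
    then show "(f \<longlongrightarrow> f x) (at x within S)" by (simp add: LIM_zero_iff)
  qed
qed

lemma lipschitz_wrt_trunc_imp_continuous_on:
  fixes f :: "real ^ 'd::finite \<Rightarrow> complex"
  assumes "lipschitz_wrt_trunc \<alpha> K L f" "0 < \<alpha>" "0 \<le> L"
  shows "continuous_on std_simplex f"
proof (rule holder_imp_continuous_on)
  show "holder_on \<alpha> std_simplex f"
    unfolding holder_on_def
  proof (intro exI ballI)
    fix x y :: "real ^ 'd" assume "x \<in> std_simplex" "y \<in> std_simplex"
    then have "norm (f x - f y) \<le> L * min 1 (K * norm (x - y) powr \<alpha>)"
      using assms(1) by (auto simp: lipschitz_wrt_trunc_def)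
    also have "\<dots> \<le> L * (K * norm (x - y) powr \<alpha>)"
      using \<open>0 \<le> L\<close> by (intro mult_left_mono) auto
    finally show "norm (f x - f y) \<le> L * K * norm (x - y) powr \<alpha>" by (simp add: mult.assoc)
  qed
qed fact

lemma continuous_on_trunc_powr:
  assumes "0 < \<alpha>" shows "continuous_on {0..1} (\<lambda>t::real. min 1 (M * t powr \<alpha>))"
  using assms by (intro continuous_on_min continuous_on_mult continuous_on_const
      continuous_on_powr' continuous_on_id) auto

text \<open>The inequality is strict because the integrand vanishes at \<open>0\<close> and is continuous.\<close>

lemma integral_trunc_powr_less_1:
  assumes "0 < \<alpha>" "0 < M"
  shows "integral {0..1} (\<lambda>t::real. min 1 (M * t powr \<alpha>)) < 1"
proof -
  define g where "g t = 1 - min 1 (M * t powr \<alpha>)" for t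
  have cont: "continuous_on {0..1} g"
    unfolding g_def by (intro continuous_on_diff continuous_on_const continuous_on_trunc_powr assms)
  have "integral {0..1} g \<noteq> 0"
  proof
    assume "integral {0..1} g = 0"
    then have "\<forall>t\<in>{0..1}. g t = 0"
      using cont by (subst (asm) integral_eq_0_iff) (auto simp: g_def)
    then show False by (auto simp: g_def dest!: bspec[where x = 0])
  qed
  moreover have "integral {0..1} g \<ge> 0"
    by (intro integral_nonneg integrable_continuous_interval cont) (auto simp: g_def)
  moreover have "integral {0..1} g = 1 - integral {0..1} (\<lambda>t. min 1 (M * t powr \<alpha>))"
    unfolding g_def
    by (subst integral_diff)
       (auto intro!: integrable_continuous_interval continuous_on_trunc_powr assms)
  ultimately show ?thesis by linarith
qed

text \<open>Moving both points with the same \<open>t\<close> towards the same vertex multiplies their difference by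
  \<open>t\<close>; the factor \<open>1 / (1 + \<alpha>)\<close> is the mean of \<open>t powr \<alpha>\<close>. This is useful when \<open>x\<close> and \<open>y\<close> are
  close, where the truncation is not felt.\<close>

lemma same_edge_average_near:
  assumes f: "lipschitz_wrt_trunc \<alpha> K L f" and "0 < \<alpha>" "0 \<le> L" "0 \<le> K"
    and x: "x \<in> std_simplex" and y: "y \<in> std_simplex"
  shows "norm (edge_average f j x - edge_average f j y)
      \<le> L * (K * norm (x - y) powr \<alpha> / (1 + \<alpha>))"
proof -
  define c where "c = L * (K * norm (x - y) powr \<alpha>)"
  have "((\<lambda>t. c * t powr \<alpha>) has_integral c * (1 / (1 + \<alpha>))) {0..1}"
    using has_integral_powr_from_0[of \<alpha> 1] \<open>0 < \<alpha>\<close>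
    by (intro has_integral_mult_right) (auto simp: add.commute)
  note int = this
  have "norm (edge_average f j x - edge_average f j y) \<le> integral {0..1} (\<lambda>t. c * t powr \<alpha>)"
  proof (rule edge_average_diff_le)
    show "(\<lambda>t. c * t powr \<alpha>) integrable_on {0..1}" using int by auto
    fix t :: real assume t: "0 \<le> t" "t \<le> 1"
    let ?x = "t *\<^sub>R x + (1 - t) *\<^sub>R vertex j" and ?y = "t *\<^sub>R y + (1 - t) *\<^sub>R vertex j"
    have "norm (f ?x - f ?y) \<le> L * min 1 (K * norm (?x - ?y) powr \<alpha>)"
      using t x y by (intro lipschitz_wrt_truncD[OF f] move_in_simplex)
    also have "\<dots> \<le> L * (K * norm (?x - ?y) powr \<alpha>)"
      using \<open>0 \<le> L\<close> by (intro mult_left_mono) auto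
    also have "?x - ?y = t *\<^sub>R (x - y)" by (simp add: algebra_simps)
    also have "L * (K * norm (t *\<^sub>R (x - y)) powr \<alpha>) = c * t powr \<alpha>"
      using t by (simp add: c_def powr_mult mult_ac)
    finally show "norm (f ?x - f ?y) \<le> c * t powr \<alpha>" .
  qed (use lipschitz_wrt_trunc_imp_continuous_on assms in auto)
  then show ?thesis using integral_unique[OF int] by (simp add: c_def)
qed

text \<open>The same move for points at any distance: the simplex has diameter at most \<open>2\<close>, so the
  integral does not depend on \<open>x\<close> and \<open>y\<close>, and it is less than \<open>1\<close> by
  \<open>integral_trunc_powr_less_1\<close>.\<close>

lemma same_edge_average_far:
  assumes f: "lipschitz_wrt_trunc \<alpha> K L f" and "0 < \<alpha>" "0 \<le> L" "0 \<le> K"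
    and x: "x \<in> std_simplex" and y: "y \<in> std_simplex"
  shows "norm (edge_average f j x - edge_average f j y)
      \<le> L * integral {0..1} (\<lambda>t. min 1 (K * 2 powr \<alpha> * t powr \<alpha>))"
proof -
  have "norm (edge_average f j x - edge_average f j y)
      \<le> integral {0..1} (\<lambda>t. L * min 1 (K * 2 powr \<alpha> * t powr \<alpha>))"
  proof (rule edge_average_diff_le)
    show "(\<lambda>t. L * min 1 (K * 2 powr \<alpha> * t powr \<alpha>)) integrable_on {0..1}"
      by (intro integrable_continuous_interval continuous_on_mult continuous_on_const
          continuous_on_trunc_powr assms)
    fix t :: real assume t: "0 \<le> t" "t \<le> 1"
    let ?x = "t *\<^sub>R x + (1 - t) *\<^sub>R vertex j" and ?y = "t *\<^sub>R y + (1 - t) *\<^sub>R vertex j"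
    have "norm (f ?x - f ?y) \<le> L * min 1 (K * norm (?x - ?y) powr \<alpha>)"
      using t x y by (intro lipschitz_wrt_truncD[OF f] move_in_simplex)
    also have "?x - ?y = t *\<^sub>R (x - y)" by (simp add: algebra_simps)
    also have "norm (t *\<^sub>R (x - y)) \<le> 2 * t"
      using mult_left_mono[OF simplex_diameter[OF x y], of t] t by (simp add: mult.commute)
    then have "L * min 1 (K * norm (t *\<^sub>R (x - y)) powr \<alpha>) \<le> L * min 1 (K * (2 * t) powr \<alpha>)"
      using assms(2-4) by (intro mult_left_mono min.mono powr_mono2) auto
    finally show "norm (f ?x - f ?y) \<le> L * min 1 (K * 2 powr \<alpha> * t powr \<alpha>)"
      using t by (simp add: powr_mult algebra_simps)
  qed (use lipschitz_wrt_trunc_imp_continuous_on assms in auto)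
  then show ?thesis by simp
qed

text \<open>The two assumptions on the weights complement each other. Two copies of the chain that are close
  stay together by the Hoelder condition. When they are far apart this condition says nothing, and
  the weight that is bounded below brings them together.\<close>

lemma transition_op_contracts:
  fixes p :: "'d::finite option \<Rightarrow> real ^ 'd \<Rightarrow> real"
  assumes \<alpha>: "0 < \<alpha>" and p: "weight_functions p"
    and holder: "\<forall>j. holder_on \<alpha> std_simplex (p j)"
    and pos: "\<exists>i. (INF x\<in>std_simplex. p i x) > 0"
  obtains K \<rho> where "1 \<le> K" "0 < \<rho>" "\<rho> < 1"
    "\<And>L f. 0 \<le> L \<Longrightarrow> lipschitz_wrt_trunc \<alpha> K L f \<Longrightarrow>
       lipschitz_wrt_trunc \<alpha> K (\<rho> * L) (transition_op p f)"
proof -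
  have p0: "0 \<le> p j x" and p1: "(\<Sum>j\<in>UNIV. p j x) = 1" if "x \<in> std_simplex" for j x
    using p that by (auto simp: weight_functions_def)
  have "\<forall>j. \<exists>C. \<forall>x\<in>std_simplex. \<forall>y\<in>std_simplex. norm (p j x - p j y) \<le> C * norm (x - y) powr \<alpha>"
    using holder by (auto simp: holder_on_def)
  then obtain C' where C': "\<And>j x y. x \<in> std_simplex \<Longrightarrow> y \<in> std_simplex \<Longrightarrow>
      \<bar>p j x - p j y\<bar> \<le> C' j * norm (x - y) powr \<alpha>"
    by (metis real_norm_def)
  define C where "C = max 0 (sum C' UNIV)"
  have C: "1 - (\<Sum>j\<in>UNIV. min (p j x) (p j y)) \<le> C * norm (x - y) powr \<alpha>"
    if "x \<in> std_simplex" "y \<in> std_simplex" for x y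
  proof -
    have "1 - (\<Sum>j\<in>UNIV. min (p j x) (p j y)) = (\<Sum>j\<in>UNIV. p j x - min (p j x) (p j y))"
      using p1[OF that(1)] by (simp add: sum_subtractf)
    also have "\<dots> \<le> (\<Sum>j\<in>UNIV. C' j * norm (x - y) powr \<alpha>)"
    proof (rule sum_mono)
      fix j
      have "p j x - min (p j x) (p j y) \<le> \<bar>p j x - p j y\<bar>" by simp
      then show "p j x - min (p j x) (p j y) \<le> C' j * norm (x - y) powr \<alpha>"
        using C'[OF that, of j] by linarith
    qed
    also have "\<dots> \<le> C * norm (x - y) powr \<alpha>"
      by (simp flip: sum_distrib_right add: C_def mult_right_mono)
    finally show ?thesis .
  qed
  obtain i where i: "(INF x\<in>std_simplex. p i x) > 0" using pos by blast
  define \<delta> where "\<delta> = (INF x\<in>std_simplex. p i x)"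
  have \<delta>: "\<delta> \<le> p i x" if "x \<in> std_simplex" for x
    unfolding \<delta>_def using that p0 by (intro cINF_lower) (auto simp: bdd_below_def)
  define r where "r = 1 / (1 + \<alpha>)"
  have r: "0 < r" "r < 1" using \<alpha> by (auto simp: r_def)
  \<comment> \<open>This makes \<open>r + C / K\<close> at most \<open>(1 + r) / 2\<close>, the contraction factor for close points.\<close>
  define K where "K = max 1 (2 * C / (1 - r))"
  have K: "1 \<le> K" "C \<le> (1 - r) / 2 * K"
  proof -
    show "1 \<le> K" by (simp add: K_def)
    have "2 * C / (1 - r) \<le> K" by (simp add: K_def)
    then show "C \<le> (1 - r) / 2 * K" using r by (simp add: field_simps)
  qed
  define c where "c = integral {0..1} (\<lambda>t::real. min 1 (K * 2 powr \<alpha> * t powr \<alpha>))"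
  have c: "c < 1" unfolding c_def using K(1) by (intro integral_trunc_powr_less_1 \<alpha>) auto
  define \<rho> where "\<rho> = max ((1 + r) / 2) (1 - \<delta> * (1 - c))"
  have \<rho>: "0 < \<rho>" "\<rho> < 1" using r c i by (auto simp: \<rho>_def \<delta>_def less_max_iff_disj)
  show thesis
  proof
    show "1 \<le> K" "0 < \<rho>" "\<rho> < 1" by fact+
    fix L and f :: "real ^ 'd \<Rightarrow> complex" assume L: "0 \<le> L" and f: "lipschitz_wrt_trunc \<alpha> K L f"
    show "lipschitz_wrt_trunc \<alpha> K (\<rho> * L) (transition_op p f)"
      unfolding lipschitz_wrt_trunc_def
    proof (intro ballI)
      fix x y :: "real ^ 'd" assume x: "x \<in> std_simplex" and y: "y \<in> std_simplex"
      define D where "D = K * norm (x - y) powr \<alpha>"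
      define q where "q j = min (p j x) (p j y)" for j
      define E where "E j = norm (edge_average f j x - edge_average f j y)" for j
      have q0: "0 \<le> q j" for j using p0 x y by (auto simp: q_def)
      have q1: "sum q UNIV \<le> 1"
        unfolding p1[OF x, symmetric] by (intro sum_mono) (auto simp: q_def)
      have D0: "0 \<le> D" using K(1) by (simp add: D_def)
      have any: "norm (edge_average f j x - edge_average f k y) \<le> L" for j k
      proof -
        have "norm (edge_average f j x - edge_average f k y) \<le> integral {0..1} (\<lambda>t::real. L)"
        proof (rule edge_average_diff_le)
          fix t :: real assume t: "0 \<le> t" "t \<le> 1"
          let ?x = "t *\<^sub>R x + (1 - t) *\<^sub>R vertex j" and ?y = "t *\<^sub>R y + (1 - t) *\<^sub>R vertex k"
          have "norm (f ?x - f ?y) \<le> L * min 1 (K * norm (?x - ?y) powr \<alpha>)"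
            using t x y by (intro lipschitz_wrt_truncD[OF f] move_in_simplex)
          also have "\<dots> \<le> L * 1" using L by (intro mult_left_mono) auto
          finally show "norm (f ?x - f ?y) \<le> L" by simp
        qed (use lipschitz_wrt_trunc_imp_continuous_on f \<alpha> L x y in auto)
        then show ?thesis by simp
      qed
      have step: "norm (transition_op p f x - transition_op p f y)
          \<le> (\<Sum>j\<in>UNIV. q j * E j) + (1 - sum q UNIV) * L"
        unfolding transition_op_eq_edge_average q_def E_def
        using p0 p1 x y any by (intro coupled_sum_diff_le) auto
      show "norm (transition_op p f x - transition_op p f y) \<le> \<rho> * L * min 1 D"
      proof (cases "D \<le> 1")
        case True
        have "(\<Sum>j\<in>UNIV. q j * E j) \<le> (\<Sum>j\<in>UNIV. q j * (L * (r * D)))"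
          using same_edge_average_near[OF f \<alpha> L _ x y] K(1) q0
          by (intro sum_mono mult_left_mono) (auto simp: E_def D_def r_def)
        also have "\<dots> \<le> 1 * (L * (r * D))"
          unfolding sum_distrib_right[symmetric]
          using q1 L r D0 by (intro mult_right_mono) auto
        finally have near: "(\<Sum>j\<in>UNIV. q j * E j) \<le> L * (r * D)" by simp
        have "1 - sum q UNIV \<le> C * norm (x - y) powr \<alpha>" using C[OF x y] by (simp add: q_def)
        also have "\<dots> \<le> (1 - r) / 2 * D"
          using mult_right_mono[OF K(2), of "norm (x - y) powr \<alpha>"] by (simp add: D_def mult_ac)
        finally have "(1 - sum q UNIV) * L \<le> (1 - r) / 2 * D * L" by (intro mult_right_mono L)
        then have "norm (transition_op p f x - transition_op p f y) \<le> (1 + r) / 2 * (L * D)"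
          using step near by (simp add: field_simps)
        also have "\<dots> \<le> \<rho> * (L * D)"
          using L D0 by (intro mult_right_mono) (auto simp: \<rho>_def)
        finally show ?thesis using True by (simp add: mult_ac)
      next
        case False
        have qi: "\<delta> \<le> q i" using \<delta> x y by (simp add: q_def)
        have "(\<Sum>j\<in>UNIV. q j * E j) = q i * E i + (\<Sum>j\<in>UNIV - {i}. q j * E j)"
          by (simp add: sum.remove)
        also have "\<dots> \<le> q i * (L * c) + (\<Sum>j\<in>UNIV - {i}. q j * L)"
          using same_edge_average_far[OF f \<alpha> L _ x y] any K(1) q0
          by (intro add_mono sum_mono mult_left_mono) (auto simp: E_def c_def)
        also have "\<dots> = q i * (L * c) + (sum q UNIV - q i) * L"
          by (simp add: sum_distrib_right[symmetric] sum_diff1)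
        finally have "norm (transition_op p f x - transition_op p f y) \<le> L * (1 - q i * (1 - c))"
          using step by (simp add: algebra_simps)
        also have "\<dots> \<le> L * (1 - \<delta> * (1 - c))"
          using qi c L by (intro mult_left_mono diff_left_mono mult_right_mono) auto
        also have "\<dots> \<le> L * \<rho>" using L by (intro mult_left_mono) (auto simp: \<rho>_def)
        finally show ?thesis using False by (simp add: mult_ac)
      qed
    qed
  qed
qed

section \<open>One step of the chain on measures\<close>

text \<open>The vertex \<open>j\<close> carries counting measure here; its probability \<open>p j x\<close>, which depends on the
  current state, enters \<open>chain_step\<close> as a density.\<close>

definition choice_space :: "('d::finite option \<times> real) measure" where
  "choice_space = count_space UNIV \<Otimes>\<^sub>M restrict_space lborel {0..1}"

definition chain_step ::
  "('d::finite option \<Rightarrow> real ^ 'd \<Rightarrow> real) \<Rightarrow> (real ^ 'd) measure \<Rightarrow> (real ^ 'd) measure" where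
  "chain_step p \<mu> =
     distr (density (\<mu> \<Otimes>\<^sub>M choice_space) (\<lambda>(x, j, t). ennreal (p j x)))
       (restrict_space borel std_simplex) (\<lambda>(x, j, t). t *\<^sub>R x + (1 - t) *\<^sub>R vertex j)"

lemma borel_prob_on_simplexD:
  assumes "borel_prob_on_simplex \<mu>"
  shows "prob_space \<mu>" "space \<mu> = std_simplex"
    "sets \<mu> = sets (restrict_space borel std_simplex)"
  using assms sets_eq_imp_space_eq[of \<mu> "restrict_space borel std_simplex"]
  by (auto simp: borel_prob_on_simplex_def space_restrict_space)

lemma measurable_on_simplex_iff:
  assumes "borel_prob_on_simplex \<mu>"
  shows "f \<in> measurable \<mu> N \<longleftrightarrow> f \<in> measurable (restrict_space borel std_simplex) N"
  using borel_prob_on_simplexD(3)[OF assms] by (simp cong: measurable_cong_sets)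

lemma continuous_on_simplex_measurable:
  assumes "borel_prob_on_simplex \<mu>"
    and "continuous_on std_simplex f"
  shows "f \<in> borel_measurable \<mu>"
  using assms by (simp add: measurable_on_simplex_iff borel_measurable_continuous_on_restrict)

lemma weight_le_1:
  assumes "weight_functions p" "x \<in> std_simplex" shows "p j x \<le> 1"
  using assms member_le_sum[of j UNIV "\<lambda>j. p j x"] by (auto simp: weight_functions_def)

lemma prob_space_unit_interval: "prob_space (restrict_space lborel {0..1::real})"
  by (auto simp: space_restrict_space emeasure_restrict_space intro!: prob_spaceI)

lemma finite_measure_choice_space: "finite_measure (choice_space :: ('d::finite option \<times> real) measure)"
  unfolding choice_space_def
  by (intro finite_measure_pair_measure finite_measure_count_space prob_space.finite_measure
      prob_space_unit_interval) auto

lemma space_choice_space: "space choice_space = UNIV \<times> {0..1}"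
  by (simp add: choice_space_def space_pair_measure space_restrict_space)

lemma weight_measurable:
  assumes p: "weight_functions p" and \<mu>: "borel_prob_on_simplex \<mu>"
  shows "(\<lambda>(x, j, t). p j x) \<in> borel_measurable (\<mu> \<Otimes>\<^sub>M choice_space)"
proof -
  have [measurable]: "p j \<in> borel_measurable \<mu>" for j
    using p \<mu> by (intro continuous_on_simplex_measurable) (auto simp: weight_functions_def)
  have "(\<lambda>z. p (fst (snd z)) (fst z)) \<in> borel_measurable (\<mu> \<Otimes>\<^sub>M choice_space)"
    by (rule measurable_compose_countable) (simp_all add: choice_space_def)
  then show ?thesis by (simp add: case_prod_unfold)
qed

lemma move_measurable:
  fixes \<mu> :: "(real ^ 'd::finite) measure"
  assumes \<mu>: "borel_prob_on_simplex \<mu>"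
  shows "(\<lambda>(x, j :: 'd option, t). t *\<^sub>R x + (1 - t) *\<^sub>R vertex j)
    \<in> measurable (\<mu> \<Otimes>\<^sub>M choice_space) (restrict_space borel std_simplex)"
proof (rule measurable_restrict_space2)
  show "(\<lambda>(x, j, t). t *\<^sub>R x + (1 - t) *\<^sub>R vertex j) \<in> space (\<mu> \<Otimes>\<^sub>M choice_space) \<rightarrow> std_simplex"
    using borel_prob_on_simplexD[OF \<mu>]
    by (auto simp: space_pair_measure space_choice_space move_in_simplex)
  let ?N = "\<mu> \<Otimes>\<^sub>M (choice_space :: ('d option \<times> real) measure)"
  have "(\<lambda>x. x) \<in> borel_measurable \<mu>"
    by (intro continuous_on_simplex_measurable \<mu> continuous_on_id)
  then have x: "(\<lambda>z. fst z) \<in> borel_measurable ?N"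
    by (rule measurable_compose[OF measurable_fst])
  have "(\<lambda>t. t) \<in> borel_measurable (restrict_space lborel {0..1::real})"
    by (rule measurable_restrict_space1) simp
  then have t: "(\<lambda>z. snd (snd z)) \<in> borel_measurable ?N"
    unfolding choice_space_def
    by (rule measurable_compose[OF measurable_compose[OF measurable_snd measurable_snd]])
  have v: "(\<lambda>z. vertex (fst (snd z))) \<in> borel_measurable ?N"
    unfolding choice_space_def
    by (rule measurable_compose[OF measurable_compose[OF measurable_snd measurable_fst]]) simp
  show "(\<lambda>(x, j, t). t *\<^sub>R x + (1 - t) *\<^sub>R vertex j) \<in> borel_measurable ?N"
    using x t v by (simp add: case_prod_unfold)
qed

lemma integral_weighted_choice:
  fixes F :: "(real ^ 'd::finite) \<times> 'd option \<times> real \<Rightarrow> 'b::{banach, second_countable_topology}"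
  assumes p: "weight_functions p" and \<mu>: "borel_prob_on_simplex \<mu>"
    and F: "F \<in> borel_measurable (\<mu> \<Otimes>\<^sub>M choice_space)"
    and bound: "\<And>z. z \<in> space (\<mu> \<Otimes>\<^sub>M choice_space) \<Longrightarrow> norm (F z) \<le> B"
  shows "integrable (\<mu> \<Otimes>\<^sub>M choice_space) (\<lambda>(x, j, t). p j x *\<^sub>R F (x, j, t))" (is "integrable ?N ?G")
    and "(LINT z|(\<mu> \<Otimes>\<^sub>M choice_space). (case z of (x, j, t) \<Rightarrow> p j x *\<^sub>R F (x, j, t))) =
      (LINT x|\<mu>. (\<Sum>j\<in>UNIV. p j x *\<^sub>R (LINT t:{0..1}|lborel. F (x, j, t))))"
proof -
  let ?U = "restrict_space lborel {0..1::real}"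
  interpret \<mu>: prob_space \<mu> by (rule borel_prob_on_simplexD[OF \<mu>])
  interpret U: prob_space ?U by (rule prob_space_unit_interval)
  interpret C: finite_measure "count_space (UNIV :: 'd option set)"
    by (rule finite_measure_count_space) simp
  interpret CU: finite_measure "choice_space :: ('d option \<times> real) measure"
    by (rule finite_measure_choice_space)
  interpret N: finite_measure ?N
    by (intro finite_measure_pair_measure \<mu>.finite_measure_axioms CU.finite_measure_axioms)
  interpret pN: pair_sigma_finite \<mu> "choice_space :: ('d option \<times> real) measure" ..
  interpret pC: pair_sigma_finite "count_space (UNIV :: 'd option set)" ?U ..
  have sp: "space \<mu> = std_simplex" by (rule borel_prob_on_simplexD[OF \<mu>])
  have G_meas: "?G \<in> borel_measurable ?N"
    using borel_measurable_scaleR[OF weight_measurable[OF p \<mu>] F] by (simp add: case_prod_unfold)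
  have G_bound: "norm (?G z) \<le> B" if "z \<in> space ?N" for z
  proof -
    obtain x j t where z: "z = (x, j, t)" by (metis surj_pair)
    have x: "x \<in> std_simplex" using that by (simp add: z space_pair_measure sp)
    have "norm (?G z) = p j x * norm (F z)"
      using p x by (simp add: z weight_functions_def)
    also have "\<dots> \<le> 1 * norm (F z)" by (intro mult_right_mono weight_le_1[OF p x]) simp
    finally show ?thesis using bound[OF that] by simp
  qed
  show int: "integrable ?N ?G"
    using G_bound by (intro N.integrable_const_bound[where B = B] AE_I2 G_meas)
  have "(LINT z|?N. ?G z) = (LINT x|\<mu>. LINT y|choice_space. ?G (x, y))"
    by (rule pN.integral_fst'[symmetric, OF int])
  also have "\<dots> = (LINT x|\<mu>. (\<Sum>j\<in>UNIV. p j x *\<^sub>R (LINT t:{0..1}|lborel. F (x, j, t))))"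
  proof (rule Bochner_Integration.integral_cong[OF refl])
    fix x assume x: "x \<in> space \<mu>"
    have "(\<lambda>y. ?G (x, y)) \<in> borel_measurable choice_space"
      using measurable_compose[OF measurable_Pair1'[OF x] G_meas] by simp
    then have "integrable choice_space (\<lambda>y. ?G (x, y))"
      using x G_bound
      by (intro CU.integrable_const_bound[where B = B] AE_I2) (auto simp: space_pair_measure)
    then have "(LINT y|choice_space. ?G (x, y))
        = (LINT j|count_space UNIV. LINT t|?U. ?G (x, j, t))"
      unfolding choice_space_def by (subst pC.integral_fst'[symmetric]) simp_all
    also have "\<dots> = (\<Sum>j\<in>UNIV. LINT t|?U. ?G (x, j, t))"
      by (rule lebesgue_integral_count_space_finite) simp
    finally show "(LINT y|choice_space. ?G (x, y))
        = (\<Sum>j\<in>UNIV. p j x *\<^sub>R (LINT t:{0..1}|lborel. F (x, j, t)))"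
      by (simp add: integral_restrict_space set_lebesgue_integral_def scaleR_left_commute)
  qed
  finally show "(LINT z|?N. ?G z) = \<dots>" .
qed

lemma chain_step_prob:
  assumes p: "weight_functions p" and \<mu>: "borel_prob_on_simplex \<mu>"
  shows "borel_prob_on_simplex (chain_step p \<mu>)"
proof -
  interpret \<mu>: prob_space \<mu> by (rule borel_prob_on_simplexD[OF \<mu>])
  let ?N = "\<mu> \<Otimes>\<^sub>M choice_space"
  have nonneg: "AE z in ?N. 0 \<le> (case z of (x, j, t) \<Rightarrow> p j x)"
    using p borel_prob_on_simplexD[OF \<mu>]
    by (intro AE_I2) (auto simp: space_pair_measure weight_functions_def)
  note int = integral_weighted_choice[OF p \<mu>, where F = "\<lambda>_. 1::real" and B = 1, simplified]
  have "prob_space (density ?N (\<lambda>(x, j, t). ennreal (p j x)))"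
  proof (rule prob_spaceI)
    have "emeasure (density ?N (\<lambda>(x, j, t). ennreal (p j x))) (space ?N)
        = (\<integral>\<^sup>+ z. ennreal (case z of (x, j, t) \<Rightarrow> p j x) \<partial>?N)"
      using weight_measurable[OF p \<mu>]
      by (subst emeasure_density)
         (auto simp: case_prod_unfold intro!: nn_integral_cong split: split_indicator)
    also have "\<dots> = ennreal (LINT z|?N. (case z of (x, j, t) \<Rightarrow> p j x))"
      using int(1) nonneg by (intro nn_integral_eq_integral)
    also have "(LINT z|?N. (case z of (x, j, t) \<Rightarrow> p j x)) = (LINT x|\<mu>. (\<Sum>j\<in>UNIV. p j x))"
      using int(2) by (simp add: set_lebesgue_integral_def)
    also have "\<dots> = (LINT x|\<mu>. 1)"
      using p borel_prob_on_simplexD(2)[OF \<mu>]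
      by (intro Bochner_Integration.integral_cong) (auto simp: weight_functions_def)
    finally show "emeasure (density ?N (\<lambda>(x, j, t). ennreal (p j x)))
        (space (density ?N (\<lambda>(x, j, t). ennreal (p j x)))) = 1"
      by (simp add: \<mu>.prob_space)
  qed
  then have "prob_space (chain_step p \<mu>)"
    unfolding chain_step_def using move_measurable[OF \<mu>] by (intro prob_space.prob_space_distr) auto
  then show ?thesis by (simp add: borel_prob_on_simplex_def chain_step_def)
qed

text \<open>The measure \<open>chain_step p \<mu>\<close> is the image of \<open>\<mu>\<close> under the dual of the transition operator,
  so invariance of \<open>\<mu>\<close> amounts to being a fixed point of \<open>chain_step p\<close>.\<close>

lemma integral_chain_step:
  assumes p: "weight_functions p" and \<mu>: "borel_prob_on_simplex \<mu>"
    and f: "f \<in> borel_measurable (restrict_space borel std_simplex)"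
    and bounded: "bounded (f ` std_simplex)"
  shows "(LINT x|chain_step p \<mu>. f x) = (LINT x|\<mu>. transition_op p f x)"
proof -
  let ?N = "\<mu> \<Otimes>\<^sub>M choice_space"
  let ?m = "\<lambda>(x, j, t). t *\<^sub>R x + (1 - t) *\<^sub>R vertex j"
  obtain B where B: "\<And>x. x \<in> std_simplex \<Longrightarrow> norm (f x) \<le> B"
    using bounded by (auto simp: bounded_iff)
  have m: "?m \<in> measurable ?N (restrict_space borel std_simplex)" by (rule move_measurable[OF \<mu>])
  have fm: "(\<lambda>z. f (?m z)) \<in> borel_measurable ?N" by (rule measurable_compose[OF m f])
  have nonneg: "AE z in ?N. 0 \<le> (case z of (x, j, t) \<Rightarrow> p j x)"
    using p borel_prob_on_simplexD[OF \<mu>]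
    by (intro AE_I2) (auto simp: space_pair_measure weight_functions_def)
  have "(LINT x|chain_step p \<mu>. f x) =
      (LINT z|(density ?N (\<lambda>z. ennreal (case z of (x, j, t) \<Rightarrow> p j x))). f (?m z))"
    unfolding chain_step_def using m f
    by (subst integral_distr) (auto simp: case_prod_unfold)
  also have "\<dots> = (LINT z|?N. (case z of (x, j, t) \<Rightarrow> p j x) *\<^sub>R f (?m z))"
    by (rule integral_density[OF fm weight_measurable[OF p \<mu>] nonneg])
  also have "\<dots> = (LINT z|?N. (case z of (x, j, t) \<Rightarrow> p j x *\<^sub>R f (?m (x, j, t))))"
    by (simp add: case_prod_unfold)
  also have "\<dots> = (LINT x|\<mu>. (\<Sum>j\<in>UNIV. p j x *\<^sub>R (LINT t:{0..1}|lborel. f (?m (x, j, t)))))"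
    using measurable_space[OF m]
    by (intro integral_weighted_choice[OF p \<mu> fm, of B] B) (simp add: space_restrict_space)
  finally show ?thesis by (simp add: transition_op_def scaleR_conv_of_real)
qed

section \<open>Schoenberg's curve and sequential compactness\<close>

text \<open>The curve reads the ternary digits \<open>0\<close> and \<open>2\<close> of its parameter and uses them as binary
  digits of the coordinates. Hence a point has an explicit preimage, the number in the Cantor set
  whose digits are the interleaved binary digits of the coordinates, and this preimage is a Borel
  function of the point.\<close>

definition ternary :: "(nat \<Rightarrow> bool) \<Rightarrow> real" where
  "ternary b = (\<Sum>k. 2 * of_bool (b k) / 3 ^ Suc k)"

lemma ternary_bound_sums: "(\<lambda>k. 2 / 3 ^ Suc k :: real) sums 1"
  using sums_mult[OF geometric_sums[of "1 / 3 :: real"], of "2 / 3"]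
  by (simp add: power_divide)

lemma ternary_summable: "summable (\<lambda>k. 2 * of_bool (b k) / 3 ^ Suc k :: real)"
  by (rule summable_comparison_test'[OF sums_summable[OF ternary_bound_sums], of 0])
     (auto simp: of_bool_def)

lemma ternary_bounds: "0 \<le> ternary b" "ternary b \<le> 1"
proof -
  show "0 \<le> ternary b" unfolding ternary_def by (intro suminf_nonneg ternary_summable) auto
  have "ternary b \<le> (\<Sum>k. 2 / 3 ^ Suc k)"
    unfolding ternary_def
    by (intro suminf_le ternary_summable sums_summable[OF ternary_bound_sums])
       (auto simp: of_bool_def)
  then show "ternary b \<le> 1" using sums_unique[OF ternary_bound_sums] by simp
qed

lemma ternary_shift: "ternary b = (2 * of_bool (b 0) + ternary (\<lambda>k. b (Suc k))) / 3"
proof -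
  have "ternary b = (\<Sum>k. 2 * of_bool (b (Suc k)) / 3 ^ Suc (Suc k)) + 2 * of_bool (b 0) / 3"
    unfolding ternary_def using suminf_split_head[OF ternary_summable[of b]] by simp
  also have "(\<Sum>k. 2 * of_bool (b (Suc k)) / 3 ^ Suc (Suc k))
      = (\<Sum>k. 2 * of_bool (b (Suc k)) / 3 ^ Suc k / 3 :: real)"
    by (intro suminf_cong) simp
  also have "\<dots> = ternary (\<lambda>k. b (Suc k)) / 3"
    unfolding ternary_def by (rule suminf_divide[OF ternary_summable])
  finally show ?thesis by (simp add: add_divide_distrib)
qed

lemma ternary_scaled: "\<exists>m::nat. 3 ^ n * ternary b = 2 * real m + ternary (\<lambda>k. b (k + n))"
proof (induction n)
  case 0
  show ?case by (intro exI[of _ 0]) simp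
next
  case (Suc n)
  then obtain m where m: "3 ^ n * ternary b = 2 * real m + ternary (\<lambda>k. b (k + n))" by blast
  have "3 ^ Suc n * ternary b = 2 * real (3 * m + of_bool (b n)) + ternary (\<lambda>k. b (k + Suc n))"
    using m ternary_shift[of "\<lambda>k. b (k + n)"] by (simp add: mult.assoc)
  then show ?case by blast
qed

text \<open>Any continuous function of period \<open>2\<close> that is \<open>0\<close> on \<open>[0, 1/3]\<close> and \<open>1\<close> on \<open>[2/3, 1]\<close>
  would do in place of \<open>wave\<close>.\<close>

definition wave :: "real \<Rightarrow> real" where
  "wave t = max 0 (min 1 (1 / 2 - cos (pi * t)))"

lemma wave_bounds: "0 \<le> wave t" "wave t \<le> 1"
  by (auto simp: wave_def)

lemma continuous_on_wave [continuous_intros]: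
  fixes f :: "real \<Rightarrow> real"
  shows "continuous_on A f \<Longrightarrow> continuous_on A (\<lambda>t. wave (f t))"
  unfolding wave_def by (intro continuous_on_max continuous_on_min continuous_intros)

text \<open>Up to an even integer, \<open>3 ^ n * ternary b\<close> is the number with digits \<open>b n, b (n + 1), \<dots>\<close>; it
  lies in \<open>[0, 1/3]\<close> or in \<open>[2/3, 1]\<close> according to its first digit.\<close>

lemma wave_reads_digit: "wave (3 ^ n * ternary b) = of_bool (b n)"
proof -
  obtain m where m: "3 ^ n * ternary b = 2 * real m + ternary (\<lambda>k. b (k + n))"
    using ternary_scaled by blast
  define u where "u = ternary (\<lambda>k. b (k + n))"
  have u: "2 * of_bool (b n) / 3 \<le> u" "u \<le> 2 * of_bool (b n) / 3 + 1 / 3"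
    using ternary_shift[of "\<lambda>k. b (k + n)"] ternary_bounds[of "\<lambda>k. b (Suc k + n)"]
    by (auto simp: u_def field_simps)
  have "cos (pi * (3 ^ n * ternary b)) = cos (pi * u + 2 * real m * pi)"
    unfolding m u_def by (simp add: algebra_simps)
  also have "\<dots> = cos (pi * u)" by (simp add: cos_add)
  finally have eq: "wave (3 ^ n * ternary b) = wave u" by (simp add: wave_def)
  show ?thesis
  proof (cases "b n")
    case True
    then have "pi * (2 / 3) \<le> pi * u" "pi * u \<le> pi * 1"
      using u by (auto intro!: mult_left_mono simp del: mult_1_right)
    then have "cos (pi * u) \<le> cos (pi * (2 / 3))" by (intro cos_monotone_0_pi_le) auto
    then have "cos (pi * u) \<le> - (1 / 2)" using cos_120 by (simp add: mult.commute)
    then show ?thesis using True eq by (simp add: wave_def)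
  next
    case False
    then have "0 \<le> pi * u" "pi * u \<le> pi * (1 / 3)"
      using u by (auto intro!: mult_left_mono simp del: mult_1_right)
    then have "cos (pi * u) \<ge> cos (pi * (1 / 3))" by (intro cos_monotone_0_pi_le) auto
    then have "cos (pi * u) \<ge> 1 / 2" using cos_60 by simp
    then show ?thesis using False eq by (simp add: wave_def)
  qed
qed

lemma binary_expansion:
  fixes x :: real
  assumes "0 \<le> x" "x < 2"
  shows "(\<lambda>k. of_bool (odd \<lfloor>2 ^ k * x\<rfloor>) / 2 ^ k) sums x"
proof -
  \<comment> \<open>The sum telescopes, since \<open>\<lfloor>2 * y\<rfloor>\<close> is \<open>2 * \<lfloor>y\<rfloor>\<close> plus its parity.\<close>
  have partial: "(\<Sum>k<Suc n. of_bool (odd \<lfloor>2 ^ k * x\<rfloor>) / 2 ^ k :: real) = of_int \<lfloor>2 ^ n * x\<rfloor> / 2 ^ n" for n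
  proof (induction n)
    case 0
    have "\<lfloor>x\<rfloor> = 0 \<or> \<lfloor>x\<rfloor> = 1" using assms by linarith
    then show ?case by auto
  next
    case (Suc n)
    define y where "y = 2 ^ n * x"
    have "\<lfloor>2 * y\<rfloor> = 2 * \<lfloor>y\<rfloor> \<or> \<lfloor>2 * y\<rfloor> = 2 * \<lfloor>y\<rfloor> + 1" by linarith
    then have "real_of_int \<lfloor>2 * y\<rfloor> = 2 * of_int \<lfloor>y\<rfloor> + of_bool (odd \<lfloor>2 * y\<rfloor>)" by auto
    then have "real_of_int \<lfloor>2 ^ Suc n * x\<rfloor> = 2 * of_int \<lfloor>2 ^ n * x\<rfloor> + of_bool (odd \<lfloor>2 ^ Suc n * x\<rfloor>)"
      by (simp add: y_def mult.assoc)
    then show ?case using Suc by (simp add: field_simps)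
  qed
  have "(\<lambda>n. of_int \<lfloor>2 ^ n * x\<rfloor> / 2 ^ n - x) \<longlonglongrightarrow> 0"
  proof (rule Lim_null_comparison)
    show "(\<lambda>n. (1 / 2 :: real) ^ n) \<longlonglongrightarrow> 0" by (rule LIMSEQ_power_zero) simp
    have "norm (of_int \<lfloor>2 ^ n * x\<rfloor> / 2 ^ n - x) \<le> (1 / 2) ^ n" for n
    proof -
      have "of_int \<lfloor>2 ^ n * x\<rfloor> / 2 ^ n - x = (of_int \<lfloor>2 ^ n * x\<rfloor> - 2 ^ n * x) / 2 ^ n"
        by (simp add: field_simps)
      moreover have "\<bar>of_int \<lfloor>2 ^ n * x\<rfloor> - 2 ^ n * x\<bar> \<le> 1" by linarith
      ultimately show ?thesis by (simp add: power_divide divide_right_mono)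
    qed
    then show "\<forall>\<^sub>F n in sequentially. norm (of_int \<lfloor>2 ^ n * x\<rfloor> / 2 ^ n - x) \<le> (1 / 2) ^ n" by simp
  qed
  then have "(\<lambda>n. of_int \<lfloor>2 ^ n * x\<rfloor> / 2 ^ n) \<longlonglongrightarrow> x" by (simp add: LIM_zero_iff)
  then have "(\<lambda>n. \<Sum>k<Suc n. of_bool (odd \<lfloor>2 ^ k * x\<rfloor>) / 2 ^ k) \<longlonglongrightarrow> x" by (simp only: partial)
  then show ?thesis unfolding sums_def by (rule LIMSEQ_imp_Suc)
qed

text \<open>The pairing of \<open>(k, i)\<close> with a natural number assigns a ternary place of \<open>t\<close> to the \<open>k\<close>-th
  binary digit of the \<open>i\<close>-th coordinate. The digit with \<open>k = 0\<close> has weight \<open>1\<close>, so that the cube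
  \<open>[0, 2)\<^sup>d\<close> is covered and the coordinate \<open>1\<close> needs no separate treatment.\<close>

definition schoenberg_curve :: "real \<Rightarrow> real ^ 'd::finite" where
  "schoenberg_curve t = (\<chi> i. \<Sum>k. wave (3 ^ to_nat (k :: nat, i) * t) / 2 ^ k)"

definition schoenberg_section :: "real ^ 'd::finite \<Rightarrow> real" where
  "schoenberg_section x = ternary (\<lambda>n. case from_nat n of (k :: nat, i) \<Rightarrow> odd \<lfloor>2 ^ k * x $ i\<rfloor>)"

lemma schoenberg_section_bounds: "0 \<le> schoenberg_section x" "schoenberg_section x \<le> 1"
  by (simp_all add: schoenberg_section_def ternary_bounds)

lemma schoenberg_section_inverse:
  assumes "\<And>i. 0 \<le> x $ i \<and> x $ i < 2"
  shows "schoenberg_curve (schoenberg_section x) = x"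
proof -
  have "(\<Sum>k. of_bool (odd \<lfloor>2 ^ k * x $ i\<rfloor>) / 2 ^ k) = x $ i" for i
    using binary_expansion[of "x $ i"] assms by (simp add: sums_iff)
  then show ?thesis
    by (simp add: schoenberg_curve_def schoenberg_section_def wave_reads_digit vec_eq_iff)
qed

lemma schoenberg_section_measurable: "schoenberg_section \<in> borel_measurable borel"
proof -
  have [measurable]: "(\<lambda>x :: real ^ 'd. of_bool (odd \<lfloor>2 ^ k * x $ i\<rfloor>) :: real) \<in> borel_measurable borel"
    for k i
    by (rule measurable_compose[where N = "count_space UNIV"]) (auto intro!: measurable_compose[OF _ measurable_real_floor])
  show ?thesis
    unfolding schoenberg_section_def ternary_def case_prod_unfold by measurable
qed

lemma continuous_schoenberg_curve: "continuous_on UNIV (schoenberg_curve :: real \<Rightarrow> real ^ 'd::finite)"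
proof -
  have "continuous_on UNIV (\<lambda>t. \<Sum>k. wave (3 ^ to_nat (k :: nat, i :: 'd) * t) / 2 ^ k)" for i
  proof (rule uniform_limit_theorem)
    show "uniform_limit UNIV (\<lambda>n t. \<Sum>k<n. wave (3 ^ to_nat (k, i) * t) / 2 ^ k)
        (\<lambda>t. \<Sum>k. wave (3 ^ to_nat (k, i) * t) / 2 ^ k) sequentially"
    proof (rule Weierstrass_m_test)
      show "norm (wave (3 ^ to_nat (k, i) * t) / 2 ^ k) \<le> (1 / 2) ^ k" for k t
        using wave_bounds by (simp add: power_divide divide_right_mono)
      show "summable (\<lambda>k. (1 / 2 :: real) ^ k)" by (rule summable_geometric) simp
    qed
    show "\<forall>\<^sub>F n in sequentially.
        continuous_on UNIV (\<lambda>t. \<Sum>k<n. wave (3 ^ to_nat (k, i) * t) / 2 ^ k)"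
      by (intro always_eventually allI continuous_intros) auto
  qed simp
  then show ?thesis unfolding schoenberg_curve_def by (intro continuous_on_vec_lambda)
qed

text \<open>Composing the curve with the nearest-point projection onto \<open>S\<close> gives a continuous map \<open>g\<close> from
  the line to \<open>S\<close> that still inverts the section on \<open>S\<close>. So \<open>f \<circ> g\<close> is bounded and continuous
  whenever \<open>f\<close> is continuous on \<open>S\<close>, and weak convergence on the line gives the claim. Convexity
  of \<open>S\<close> makes the projection single-valued and continuous.\<close>

lemma convergent_subsequence_of_measures:
  fixes S :: "(real ^ 'd::finite) set" and \<mu> :: "nat \<Rightarrow> (real ^ 'd) measure"
  assumes S: "compact S" "convex S" "S \<noteq> {}"
    and cube: "\<And>x i. x \<in> S \<Longrightarrow> 0 \<le> x $ i \<and> x $ i < 2"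
    and prob: "\<And>n. prob_space (\<mu> n)" and sets: "\<And>n. sets (\<mu> n) = sets (restrict_space borel S)"
  obtains r \<nu> where "strict_mono r" "prob_space \<nu>" "sets \<nu> = sets (restrict_space borel S)"
    "\<And>f :: real ^ 'd \<Rightarrow> complex. continuous_on S f \<Longrightarrow>
       (\<lambda>n. LINT x|\<mu> (r n). f x) \<longlonglongrightarrow> (LINT x|\<nu>. f x)"
proof -
  define g :: "real \<Rightarrow> real ^ 'd" where "g = closest_point S \<circ> schoenberg_curve"
  have closed: "closed S" using S compact_imp_closed by blast
  have g_cont: "continuous_on UNIV g"
    unfolding g_def
    by (intro continuous_on_compose continuous_schoenberg_curve continuous_on_closest_point S closed)
  have g_in: "g t \<in> S" for t
    unfolding g_def using closest_point_in_set[OF closed] S by auto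
  have g_meas: "g \<in> measurable borel (restrict_space borel S)"
    using g_in by (intro measurable_restrict_space2 borel_measurable_continuous_onI g_cont) auto
  have gh: "g (schoenberg_section x) = x" if "x \<in> S" for x
    using schoenberg_section_inverse[of x] cube that by (simp add: g_def closest_point_self)
  have space: "space (\<mu> n) = S" for n
    using sets_eq_imp_space_eq[OF sets[of n]] by (simp add: space_restrict_space)
  have h_meas: "schoenberg_section \<in> borel_measurable (\<mu> n)" for n
    using measurable_restrict_space1[OF schoenberg_section_measurable, of S] sets
    by (simp cong: measurable_cong_sets)
  define \<mu>' where "\<mu>' n = distr (\<mu> n) borel schoenberg_section" for n
  have real_distr: "real_distribution (\<mu>' n)" for n
    unfolding \<mu>'_def by (intro prob_space.real_distribution_distr prob h_meas)
  have "tight \<mu>'"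
    unfolding tight_def
  proof (intro conjI allI impI real_distr)
    fix \<epsilon> :: real assume "\<epsilon> > 0"
    have "measure (\<mu>' n) {-1<..1} = 1" for n
    proof -
      have "-1 < schoenberg_section x \<and> schoenberg_section x \<le> 1" for x :: "real ^ 'd"
        using schoenberg_section_bounds[of x] by auto
      then have "schoenberg_section -` {-1<..1} \<inter> space (\<mu> n) = space (\<mu> n)"
        by auto
      then show ?thesis
        unfolding \<mu>'_def by (simp add: measure_distr h_meas prob_space.prob_space prob)
    qed
    then show "\<exists>a b. a < b \<and> (\<forall>n. measure (\<mu>' n) {a<..b} > 1 - \<epsilon>)"
      using \<open>\<epsilon> > 0\<close> by (intro exI[of _ "-1"] exI[of _ 1]) auto
  qed
  from tight_imp_convergent_subsubsequence[OF this, of id]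
  obtain r M where r: "strict_mono (r :: nat \<Rightarrow> nat)" and M: "real_distribution M"
    and weak: "weak_conv_m (\<mu>' \<circ> id \<circ> r) M"
    by (auto simp: strict_mono_id)
  interpret M: real_distribution M by fact
  define \<nu> where "\<nu> = distr M (restrict_space borel S) g"
  have g_measM: "g \<in> measurable M (restrict_space borel S)" using g_meas by simp
  show thesis
  proof
    show "strict_mono r" by fact
    show "prob_space \<nu>" unfolding \<nu>_def by (rule M.prob_space_distr[OF g_measM])
    show "sets \<nu> = sets (restrict_space borel S)" by (simp add: \<nu>_def)
    fix f :: "real ^ 'd \<Rightarrow> complex" assume f: "continuous_on S f"
    have f_meas: "f \<in> borel_measurable (restrict_space borel S)"
      using f by (rule borel_measurable_continuous_on_restrict)
    have "bounded (f ` S)" by (intro compact_imp_bounded compact_continuous_image f S)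
    then obtain B where B: "\<And>x. x \<in> S \<Longrightarrow> norm (f x) \<le> B" by (auto simp: bounded_iff)
    have fg_cont: "continuous_on UNIV (\<lambda>t. f (g t))"
      using g_in by (intro continuous_on_compose2[OF f g_cont]) auto
    have "(\<lambda>n. LINT t|(\<mu>' \<circ> id \<circ> r) n. f (g t)) \<longlonglongrightarrow> (LINT t|M. f (g t))"
    proof (rule weak_conv_imp_integral_bdd_continuous_conv[OF _ M weak])
      show "real_distribution ((\<mu>' \<circ> id \<circ> r) n)" for n by (simp add: real_distr)
      show "isCont (\<lambda>t. f (g t)) t" for t
        using fg_cont by (simp add: continuous_on_eq_continuous_at)
      show "norm (f (g t)) \<le> B" for t by (intro B g_in)
    qed
    moreover have "(LINT t|(\<mu>' \<circ> id \<circ> r) n. f (g t)) = (LINT x|\<mu> (r n). f x)" for n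
    proof -
      have "(LINT t|\<mu>' (r n). f (g t)) = (LINT x|\<mu> (r n). f (g (schoenberg_section x)))"
        unfolding \<mu>'_def using fg_cont
        by (intro integral_distr h_meas borel_measurable_continuous_onI)
      also have "\<dots> = (LINT x|\<mu> (r n). f x)"
        by (intro Bochner_Integration.integral_cong) (auto simp: gh space)
      finally show ?thesis by simp
    qed
    moreover have "(LINT t|M. f (g t)) = (LINT x|\<nu>. f x)"
      unfolding \<nu>_def by (rule integral_distr[OF g_measM f_meas, symmetric])
    ultimately show "(\<lambda>n. LINT x|\<mu> (r n). f x) \<longlonglongrightarrow> (LINT x|\<nu>. f x)" by simp
  qed
qed

section \<open>Testing measures against Lipschitz functions\<close>

text \<open>For closed nonempty \<open>C\<close> these functions increase with \<open>n\<close> to the indicator of the complement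
  of \<open>C\<close>, so Lipschitz functions are rich enough to determine a measure.\<close>

lemma truncated_infdist_lipschitz:
  fixes C :: "(real ^ 'd::finite) set"
  assumes "0 < \<alpha>" "\<alpha> \<le> 1" "1 \<le> K"
  shows "lipschitz_wrt_trunc \<alpha> K (2 * real n + 1)
    (\<lambda>x. complex_of_real (min 1 (real n * infdist x C)))"
  unfolding lipschitz_wrt_trunc_def
proof (intro ballI)
  fix x y :: "real ^ 'd" assume x: "x \<in> std_simplex" and y: "y \<in> std_simplex"
  define u where "u = \<bar>min 1 (real n * infdist x C) - min 1 (real n * infdist y C)\<bar>"
  define D where "D = norm (x - y) powr \<alpha>"
  have "u \<le> \<bar>real n * infdist x C - real n * infdist y C\<bar>" by (auto simp: u_def)
  also have "\<dots> = real n * \<bar>infdist x C - infdist y C\<bar>"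
    by (simp flip: right_diff_distrib add: abs_mult)
  also have "\<dots> \<le> real n * norm (x - y)"
    using infdist_triangle_abs[of x C y] by (intro mult_left_mono) (auto simp: dist_norm)
  also have "norm (x - y) \<le> 2 * D"
  proof (cases "x = y")
    case False
    have "norm (x - y) = norm (x - y) powr (1 - \<alpha>) * D"
      using False by (simp add: D_def flip: powr_add)
    also have "norm (x - y) powr (1 - \<alpha>) \<le> 2 powr (1 - \<alpha>)"
      using simplex_diameter[OF x y] assms by (intro powr_mono2) auto
    also have "2 powr (1 - \<alpha>) \<le> (2 :: real) powr 1" using assms by (intro powr_mono) auto
    finally show ?thesis by (simp add: D_def mult_right_mono)
  qed (simp add: D_def)
  finally have "u \<le> (2 * real n) * D" by (simp add: mult_left_mono)
  also have "\<dots> \<le> (2 * real n + 1) * (K * D)"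
    using assms by (intro mult_mono) (auto simp: D_def mult_le_cancel_right1)
  finally have "u \<le> (2 * real n + 1) * (K * D)" .
  moreover have "u \<le> 1"
  proof -
    have "0 \<le> real n * infdist z C" for z by (simp add: infdist_nonneg)
    from this[of x] this[of y] show ?thesis by (simp add: u_def min_def abs_if)
  qed
  ultimately have "u \<le> (2 * real n + 1) * min 1 (K * D)" by (auto simp: min_def)
  moreover have "norm (complex_of_real (min 1 (real n * infdist x C)) -
      complex_of_real (min 1 (real n * infdist y C))) = u"
    unfolding u_def by (metis norm_of_real of_real_diff)
  ultimately show "norm (complex_of_real (min 1 (real n * infdist x C)) -
      complex_of_real (min 1 (real n * infdist y C))) \<le> (2 * real n + 1) * min 1 (K * norm (x - y) powr \<alpha>)"
    by (simp add: D_def)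
qed

lemma truncated_infdist_tendsto_indicator:
  assumes "closed C" "C \<noteq> {}"
  shows "(\<lambda>n. min 1 (real n * infdist x C)) \<longlonglongrightarrow> indicator (- C) x"
proof (cases "x \<in> C")
  case True
  then show ?thesis by simp
next
  case False
  then have pos: "0 < infdist x C"
    using in_closed_iff_infdist_zero[OF assms, of x] infdist_nonneg[of x C] by linarith
  obtain N where N: "1 \<le> real N * infdist x C"
    using reals_Archimedean3[OF pos] by (metis less_le)
  have "\<forall>\<^sub>F n in sequentially. min 1 (real n * infdist x C) = indicator (- C) x"
  proof (rule eventually_sequentiallyI[of N])
    fix n assume "N \<le> n"
    then have "real N * infdist x C \<le> real n * infdist x C"
      using pos by (intro mult_right_mono) auto
    then show "min 1 (real n * infdist x C) = indicator (- C) x" using N False by simp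
  qed
  then show ?thesis by (rule tendsto_eventually)
qed

lemma measure_eqI_lipschitz:
  fixes \<mu> \<nu> :: "(real ^ 'd::finite) measure"
  assumes "0 < \<alpha>" "\<alpha> \<le> 1" "1 \<le> K"
    and \<mu>: "borel_prob_on_simplex \<mu>" and \<nu>: "borel_prob_on_simplex \<nu>"
    and eq: "\<And>L f. 0 \<le> L \<Longrightarrow> lipschitz_wrt_trunc \<alpha> K L f \<Longrightarrow> (LINT x|\<mu>. f x) = (LINT x|\<nu>. f x)"
  shows "\<mu> = \<nu>"
proof -
  have limit: "(\<lambda>n. LINT x|M. min 1 (real n * infdist x C)) \<longlonglongrightarrow> measure M (std_simplex - C)"
    if M: "borel_prob_on_simplex M" and C: "closed C" "C \<noteq> {}" for M :: "(real ^ 'd) measure" and C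
  proof -
    interpret M: prob_space M by (rule borel_prob_on_simplexD[OF M])
    have sp: "space M = std_simplex" by (rule borel_prob_on_simplexD[OF M])
    have C_meas: "- C \<inter> space M \<in> sets M"
      using borel_prob_on_simplexD(3)[OF M] C by (auto simp: sp sets_restrict_space)
    have "(\<lambda>n. LINT x|M. min 1 (real n * infdist x C)) \<longlonglongrightarrow> (LINT x|M. indicator (- C) x)"
    proof (rule integral_dominated_convergence[where w = "\<lambda>_. 1"])
      show "(\<lambda>x. min 1 (real n * infdist x C)) \<in> borel_measurable M" for n
        by (intro continuous_on_simplex_measurable M continuous_on_min continuous_intros)
      show "(\<lambda>x. indicator (- C) x :: real) \<in> borel_measurable M"
        using C_meas by (simp add: borel_measurable_indicator_iff)
      show "AE x in M. (\<lambda>n. min 1 (real n * infdist x C)) \<longlonglongrightarrow> indicator (- C) x"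
        using truncated_infdist_tendsto_indicator[OF C] by simp
      show "AE x in M. norm (min 1 (real n * infdist x C)) \<le> 1" for n
        by (intro AE_I2) (simp add: infdist_nonneg abs_of_nonneg)
    qed simp
    also have "(LINT x|M. indicator (- C) x :: real) = measure M (std_simplex - C)"
      by (simp add: sp Diff_eq Int_commute)
    finally show ?thesis .
  qed
  have closed_eq: "measure \<mu> (std_simplex - C) = measure \<nu> (std_simplex - C)" if "closed C" for C
  proof (cases "C = {}")
    case True
    then show ?thesis
      using prob_space.prob_space[OF borel_prob_on_simplexD(1)[OF \<mu>]]
        prob_space.prob_space[OF borel_prob_on_simplexD(1)[OF \<nu>]]
      by (simp add: borel_prob_on_simplexD(2)[OF \<mu>] borel_prob_on_simplexD(2)[OF \<nu>])
  next
    case False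
    have "complex_of_real (LINT x|\<mu>. min 1 (real n * infdist x C))
        = complex_of_real (LINT x|\<nu>. min 1 (real n * infdist x C))" for n
      using eq[OF _ truncated_infdist_lipschitz[OF assms(1-3), of n C]] by simp
    then have "(LINT x|\<mu>. min 1 (real n * infdist x C)) = (LINT x|\<nu>. min 1 (real n * infdist x C))" for n
      by (simp only: of_real_eq_iff)
    then show ?thesis
      using limit[OF \<mu> that False] limit[OF \<nu> that False] by (simp add: LIMSEQ_unique)
  qed
  have id_meas: "(\<lambda>x. x) \<in> borel_measurable M" if "borel_prob_on_simplex M"
    for M :: "(real ^ 'd) measure"
    by (intro continuous_on_simplex_measurable that continuous_on_id)
  \<comment> \<open>Viewed on the whole space, both measures agree on the open sets, which generate the Borel
    sets.\<close>
  have "distr \<mu> borel (\<lambda>x. x) = distr \<nu> borel (\<lambda>x. x)"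
  proof (rule measure_eqI_generator_eq[where E = "{U. open U}" and \<Omega> = UNIV and A = "\<lambda>_. UNIV"])
    fix U :: "(real ^ 'd) set" assume "U \<in> {U. open U}"
    then have U: "open U" by simp
    have "emeasure (distr M borel (\<lambda>x. x)) U = ennreal (measure M (std_simplex - (- U)))"
      if M: "borel_prob_on_simplex M" for M :: "(real ^ 'd) measure"
    proof -
      interpret M: prob_space M by (rule borel_prob_on_simplexD[OF M])
      show ?thesis
        using U by (simp add: emeasure_distr[OF id_meas[OF M]] borel_prob_on_simplexD(2)[OF M]
            M.emeasure_eq_measure Diff_eq Int_commute)
    qed
    then show "emeasure (distr \<mu> borel (\<lambda>x. x)) U = emeasure (distr \<nu> borel (\<lambda>x. x)) U"
      using closed_eq[of "- U"] U \<mu> \<nu> by (simp add: closed_def)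
  next
    show "emeasure (distr \<mu> borel (\<lambda>x. x)) UNIV \<noteq> \<infinity>"
      using prob_space.emeasure_space_1[OF prob_space.prob_space_distr[OF
            borel_prob_on_simplexD(1)[OF \<mu>] id_meas[OF \<mu>]]] by simp
  qed (auto simp: Int_stable_def sets_borel)
  then have distr_eq: "emeasure (distr \<mu> borel (\<lambda>x. x)) A = emeasure (distr \<nu> borel (\<lambda>x. x)) A" for A
    by simp
  show ?thesis
  proof (rule measure_eqI)
    show "sets \<mu> = sets \<nu>"
      using borel_prob_on_simplexD(3)[OF \<mu>] borel_prob_on_simplexD(3)[OF \<nu>] by simp
    fix A assume "A \<in> sets \<mu>"
    then have A: "A \<in> sets borel" "A \<subseteq> std_simplex"
      using borel_prob_on_simplexD(3)[OF \<mu>] by (auto simp: sets_restrict_space)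
    then show "emeasure \<mu> A = emeasure \<nu> A"
      using distr_eq[of A]
      by (simp add: emeasure_distr id_meas \<mu> \<nu> borel_prob_on_simplexD(2) Int_absorb2)
  qed
qed

section \<open>The Hoelder norm controls the truncated Lipschitz constant\<close>

text \<open>The factor \<open>2\<close> comes from bounding the oscillation of \<open>f\<close> by twice its supremum.\<close>

lemma holder_norm_bound:
  fixes f :: "real ^ 'd::finite \<Rightarrow> complex"
  assumes \<alpha>: "0 < \<alpha>" and K: "1 \<le> K" and f: "holder_on \<alpha> std_simplex f"
  shows "0 \<le> holder_norm \<alpha> std_simplex f"
    and "lipschitz_wrt_trunc \<alpha> K (2 * holder_norm \<alpha> std_simplex f) f"
proof -
  let ?A = "{(x, y). x \<in> std_simplex \<and> y \<in> std_simplex \<and> x \<noteq> y} :: ((real ^ 'd) \<times> (real ^ 'd)) set"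
  define m where "m = holder_seminorm \<alpha> std_simplex f"
  define s where "s = (SUP x\<in>std_simplex. norm (f x))"
  obtain C where C: "\<And>x y. x \<in> std_simplex \<Longrightarrow> y \<in> std_simplex \<Longrightarrow>
      norm (f x - f y) \<le> C * norm (x - y) powr \<alpha>"
    using f by (auto simp: holder_on_def)
  have "bdd_above ((\<lambda>(x, y). norm (f x - f y) / norm (x - y) powr \<alpha>) ` ?A)"
    using C by (auto intro!: bdd_aboveI[of _ C] simp: divide_le_eq)
  then have quot: "norm (f x - f y) / norm (x - y) powr \<alpha> \<le> m"
    if "x \<in> std_simplex" "y \<in> std_simplex" "x \<noteq> y" for x y
    unfolding m_def holder_seminorm_def
    using cSUP_upper[of "(x, y)" ?A "\<lambda>(x, y). norm (f x - f y) / norm (x - y) powr \<alpha>"] that by simp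
  have "bounded (f ` std_simplex)"
    by (intro compact_imp_bounded compact_continuous_image holder_imp_continuous_on[OF f \<alpha>]
        compact_simplex)
  then obtain B where "\<And>x. x \<in> std_simplex \<Longrightarrow> norm (f x) \<le> B"
    by (auto simp: bounded_iff)
  then have "bdd_above ((\<lambda>x. norm (f x)) ` std_simplex)" by (auto intro!: bdd_aboveI[of _ B])
  then have sup: "norm (f x) \<le> s" if "x \<in> std_simplex" for x
    unfolding s_def using that by (rule cSUP_upper[rotated])
  \<comment> \<open>The supremum in the seminorm ranges over a nonempty set, so it is nonnegative.\<close>
  have two: "vertex None \<noteq> (vertex (Some undefined) :: real ^ 'd)" by (simp add: vertex_def axis_eq_0_iff)
  have m0: "0 \<le> m" by (rule order_trans[OF _ quot[OF vertex_in_simplex vertex_in_simplex two]]) simp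
  have s0: "0 \<le> s" by (rule order_trans[OF norm_ge_zero sup[OF vertex_in_simplex]])
  have H: "holder_norm \<alpha> std_simplex f = s + m" by (simp add: holder_norm_def s_def m_def)
  show "0 \<le> holder_norm \<alpha> std_simplex f" using m0 s0 by (simp add: H)
  show "lipschitz_wrt_trunc \<alpha> K (2 * holder_norm \<alpha> std_simplex f) f"
    unfolding lipschitz_wrt_trunc_def H
  proof (intro ballI)
    fix x y :: "real ^ 'd" assume x: "x \<in> std_simplex" and y: "y \<in> std_simplex"
    define D where "D = norm (x - y) powr \<alpha>"
    have "norm (f x - f y) \<le> m * D"
      using quot[OF x y] by (cases "x = y") (auto simp: D_def divide_le_eq)
    also have "\<dots> \<le> (2 * (s + m)) * (K * D)"
      using m0 s0 K by (intro mult_mono) (auto simp: D_def mult_le_cancel_right1)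
    finally have "norm (f x - f y) \<le> (2 * (s + m)) * (K * D)" .
    moreover have "norm (f x - f y) \<le> 2 * (s + m)"
    proof -
      have "norm (f x - f y) \<le> norm (f x) + norm (f y)" by (rule norm_triangle_ineq4)
      also have "\<dots> \<le> s + s" by (intro add_mono sup x y)
      finally show ?thesis using m0 by (simp add: distrib_left)
    qed
    ultimately show "norm (f x - f y) \<le> 2 * (s + m) * min 1 (K * norm (x - y) powr \<alpha>)"
      by (auto simp: min_def D_def)
  qed
qed

section \<open>Invariant measure and rate of convergence\<close>

text \<open>Any contraction factor \<open>\<rho> < 1\<close> for the truncated Lipschitz constant, whatever its origin,
  leads to the invariant measure and becomes the rate of convergence.\<close>

locale contracting_chain =
  fixes p :: "'d::finite option \<Rightarrow> real ^ 'd \<Rightarrow> real" and \<alpha> K \<rho> :: real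
  assumes weights: "weight_functions p"
    and \<alpha>: "0 < \<alpha>" "\<alpha> \<le> 1" and K: "1 \<le> K" and \<rho>: "0 < \<rho>" "\<rho> < 1"
    and contracts: "\<And>L f. 0 \<le> L \<Longrightarrow> lipschitz_wrt_trunc \<alpha> K L f \<Longrightarrow>
       lipschitz_wrt_trunc \<alpha> K (\<rho> * L) (transition_op p f)"
begin

lemma iterate_lipschitz:
  assumes "0 \<le> L" "lipschitz_wrt_trunc \<alpha> K L f"
  shows "lipschitz_wrt_trunc \<alpha> K (\<rho> ^ n * L) ((transition_op p ^^ n) f)"
proof (induction n)
  case (Suc n)
  then show ?case using contracts[OF _ Suc] assms(1) \<rho> by (simp add: mult.assoc)
qed (use assms in simp)

lemma lipschitz_test_function:
  assumes "0 \<le> L" "lipschitz_wrt_trunc \<alpha> K L f"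
  shows "continuous_on std_simplex f" "bounded (f ` std_simplex)"
    "f \<in> borel_measurable (restrict_space borel std_simplex)"
proof -
  show c: "continuous_on std_simplex f"
    using assms \<alpha> by (intro lipschitz_wrt_trunc_imp_continuous_on)
  show "bounded (f ` std_simplex)"
    by (intro compact_imp_bounded compact_continuous_image c compact_simplex)
  show "f \<in> borel_measurable (restrict_space borel std_simplex)"
    by (rule borel_measurable_continuous_on_restrict[OF c])
qed

text \<open>Averaging \<open>f x - f y\<close> over \<open>y\<close> turns small oscillation into closeness to the mean.\<close>

lemma integral_close_to_value:
  assumes \<mu>: "borel_prob_on_simplex \<mu>" and L: "0 \<le> L" "lipschitz_wrt_trunc \<alpha> K L f"
    and x: "x \<in> std_simplex"
  shows "norm (f x - (LINT y|\<mu>. f y)) \<le> L"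
proof -
  interpret \<mu>: prob_space \<mu> by (rule borel_prob_on_simplexD[OF \<mu>])
  obtain B where B: "\<And>y. y \<in> std_simplex \<Longrightarrow> norm (f y) \<le> B"
    using lipschitz_test_function(2)[OF L] by (auto simp: bounded_iff)
  have "integrable \<mu> f"
    using lipschitz_test_function(3)[OF L] B
    by (intro \<mu>.integrable_const_bound[where B = B] AE_I2)
       (auto simp: measurable_on_simplex_iff[OF \<mu>] borel_prob_on_simplexD(2)[OF \<mu>])
  then have "f x - (LINT y|\<mu>. f y) = (LINT y|\<mu>. f x - f y)"
    by (simp add: \<mu>.prob_space)
  also have "norm \<dots> \<le> (LINT y|\<mu>. norm (f x - f y))" by (rule integral_norm_bound)
  also have "\<dots> \<le> L"
  proof (intro \<mu>.integral_le_const AE_I2)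
    show "integrable \<mu> (\<lambda>y. norm (f x - f y))" using \<open>integrable \<mu> f\<close> by simp
    fix y assume "y \<in> space \<mu>"
    then have "norm (f x - f y) \<le> L * min 1 (K * norm (x - y) powr \<alpha>)"
      using x by (intro lipschitz_wrt_truncD[OF L(2)]) (simp_all add: borel_prob_on_simplexD(2)[OF \<mu>])
    also have "\<dots> \<le> L * 1" using L by (intro mult_left_mono) auto
    finally show "norm (f x - f y) \<le> L" by simp
  qed
  finally show ?thesis .
qed

lemma chain_iterate_prob:
  assumes "borel_prob_on_simplex \<mu>"
  shows "borel_prob_on_simplex ((chain_step p ^^ n) \<mu>)"
  by (induction n) (simp_all add: assms chain_step_prob[OF weights])

lemma integral_chain_iterate:
  assumes \<mu>: "borel_prob_on_simplex \<mu>" and L: "0 \<le> L" "lipschitz_wrt_trunc \<alpha> K L f"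
  shows "(LINT x|(chain_step p ^^ n) \<mu>. f x) = (LINT x|\<mu>. (transition_op p ^^ n) f x)"
  using L
proof (induction n arbitrary: L f)
  case (Suc n)
  have "(LINT x|(chain_step p ^^ Suc n) \<mu>. f x) = (LINT x|(chain_step p ^^ n) \<mu>. transition_op p f x)"
    using integral_chain_step[OF weights chain_iterate_prob[OF \<mu>]]
      lipschitz_test_function(2,3)[OF Suc.prems] by simp
  also have "\<dots> = (LINT x|\<mu>. (transition_op p ^^ n) (transition_op p f) x)"
    using Suc.prems \<rho> by (intro Suc.IH[of "\<rho> * L"] contracts) auto
  finally show ?case by (simp add: funpow_swap1)
qed simp

lemma invariant_imp_rate:
  assumes \<nu>: "borel_prob_on_simplex \<nu>" and inv: "invariant_measure p \<nu>"
    and L: "0 \<le> L" "lipschitz_wrt_trunc \<alpha> K L f" and x: "x \<in> std_simplex"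
  shows "norm ((transition_op p ^^ n) f x - (LINT y|\<nu>. f y)) \<le> \<rho> ^ n * L"
proof -
  have "(LINT y|\<nu>. (transition_op p ^^ n) f y) = (LINT y|\<nu>. f y)"
  proof (induction n)
    case (Suc n)
    have L': "0 \<le> \<rho> ^ n * L" using L \<rho> by simp
    show ?case
      using inv lipschitz_test_function(2,3)[OF L' iterate_lipschitz[OF L]] Suc
      by (simp add: invariant_measure_def)
  qed simp
  then show ?thesis
    using integral_close_to_value[OF \<nu> _ iterate_lipschitz[OF L] x, of n] L \<rho> by simp
qed

lemma rate_imp_limit:
  assumes "\<And>n. norm ((transition_op p ^^ n) f x - c) \<le> \<rho> ^ n * L"
  shows "(\<lambda>n. (transition_op p ^^ n) f x) \<longlonglongrightarrow> c"
proof -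
  have "(\<lambda>n. \<rho> ^ n * L) \<longlonglongrightarrow> 0 * L" using \<rho> by (intro tendsto_intros LIMSEQ_power_zero) simp
  then have "(\<lambda>n. \<rho> ^ n * L) \<longlonglongrightarrow> 0" by simp
  then have "(\<lambda>n. (transition_op p ^^ n) f x - c) \<longlonglongrightarrow> 0"
    by (rule Lim_null_comparison[rotated]) (simp add: assms)
  then show ?thesis by (simp add: LIM_zero_iff)
qed

lemma invariant_measure_unique:
  assumes \<nu>: "borel_prob_on_simplex \<nu>" "invariant_measure p \<nu>"
    and \<nu>': "borel_prob_on_simplex \<nu>'" "invariant_measure p \<nu>'"
  shows "\<nu> = \<nu>'"
proof (rule measure_eqI_lipschitz[OF \<alpha> K \<nu>(1) \<nu>'(1)])
  fix L and f :: "real ^ 'd \<Rightarrow> complex" assume "0 \<le> L" "lipschitz_wrt_trunc \<alpha> K L f"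
  then show "(LINT x|\<nu>. f x) = (LINT x|\<nu>'. f x)"
    by (intro LIMSEQ_unique[OF rate_imp_limit[OF invariant_imp_rate[OF \<nu> _ _ vertex_in_simplex]]
          rate_imp_limit[OF invariant_imp_rate[OF \<nu>' _ _ vertex_in_simplex]]])
qed

text \<open>By the contraction, all laws of the chain at times \<open>m \<ge> n\<close> give \<open>f\<close> an integral within
  \<open>\<rho> ^ n * L\<close> of the \<open>n\<close>-th iterate of \<open>f\<close> at every \<open>x\<close>. The bound survives the passage to the
  limit along a subsequence.\<close>

lemma limit_measure_exists:
  obtains \<nu> where "borel_prob_on_simplex \<nu>"
    "\<And>L (f :: real ^ 'd \<Rightarrow> complex) x n. 0 \<le> L \<Longrightarrow> lipschitz_wrt_trunc \<alpha> K L f \<Longrightarrow> x \<in> std_simplex \<Longrightarrow>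
       norm ((transition_op p ^^ n) f x - (LINT y|\<nu>. f y)) \<le> \<rho> ^ n * L"
proof -
  define \<mu> where "\<mu> = return (restrict_space borel std_simplex) (vertex None :: real ^ 'd)"
  have \<mu>: "borel_prob_on_simplex \<mu>"
    unfolding borel_prob_on_simplex_def \<mu>_def
    by (auto intro!: prob_space_return simp: space_restrict_space vertex_in_simplex)
  let ?\<mu> = "\<lambda>m. (chain_step p ^^ m) \<mu>"
  have cube: "0 \<le> x $ i \<and> x $ i < 2" if "x \<in> std_simplex" for x :: "real ^ 'd" and i
    using that simplex_coordinate_le_1[OF that, of i] by (auto simp: std_simplex_def)
  have nonempty: "std_simplex \<noteq> ({} :: (real ^ 'd) set)" using vertex_in_simplex by blast
  obtain r \<nu> where r: "strict_mono r" and \<nu>: "prob_space \<nu>"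
      "sets \<nu> = sets (restrict_space borel std_simplex)"
    and lim: "\<And>f :: real ^ 'd \<Rightarrow> complex. continuous_on std_simplex f \<Longrightarrow>
       (\<lambda>n. LINT x|?\<mu> (r n). f x) \<longlonglongrightarrow> (LINT x|\<nu>. f x)"
    by (rule convergent_subsequence_of_measures[where \<mu> = ?\<mu>, OF compact_simplex convex_simplex nonempty],
        erule cube, rule borel_prob_on_simplexD(1)[OF chain_iterate_prob[OF \<mu>]],
        rule borel_prob_on_simplexD(3)[OF chain_iterate_prob[OF \<mu>]], rule that)
  show thesis
  proof
    show "borel_prob_on_simplex \<nu>" using \<nu> by (simp add: borel_prob_on_simplex_def)
    fix L and f :: "real ^ 'd \<Rightarrow> complex" and x :: "real ^ 'd" and n
    assume L: "0 \<le> L" "lipschitz_wrt_trunc \<alpha> K L f" and x: "x \<in> std_simplex"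
    have close: "norm ((transition_op p ^^ n) f x - (LINT y|?\<mu> m. f y)) \<le> \<rho> ^ n * L" if "n \<le> m" for m
    proof -
      have "?\<mu> m = (chain_step p ^^ n) (?\<mu> (m - n))"
        using that by (simp flip: funpow_add[THEN fun_cong, unfolded o_apply])
      then have "(LINT y|?\<mu> m. f y) = (LINT y|?\<mu> (m - n). (transition_op p ^^ n) f y)"
        using integral_chain_iterate[OF chain_iterate_prob[OF \<mu>] L] by simp
      then show ?thesis
        using integral_close_to_value[OF chain_iterate_prob[OF \<mu>] _ iterate_lipschitz[OF L] x] L \<rho>
        by simp
    qed
    have "(\<lambda>k. norm ((transition_op p ^^ n) f x - (LINT y|?\<mu> (r k). f y)))
        \<longlonglongrightarrow> norm ((transition_op p ^^ n) f x - (LINT y|\<nu>. f y))"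
      by (intro tendsto_intros lim lipschitz_test_function(1)[OF L])
    moreover have "\<forall>\<^sub>F k in sequentially.
        norm ((transition_op p ^^ n) f x - (LINT y|?\<mu> (r k). f y)) \<le> \<rho> ^ n * L"
      using seq_suble[OF r] close by (intro eventually_sequentiallyI[of n]) (meson order_trans)
    ultimately show "norm ((transition_op p ^^ n) f x - (LINT y|\<nu>. f y)) \<le> \<rho> ^ n * L"
      by (rule tendsto_upperbound) simp
  qed
qed

text \<open>The iterates of \<open>transition_op p f\<close> are those of \<open>f\<close> shifted by one, so they have the same limit.
  This gives invariance for Lipschitz \<open>f\<close>; since these determine a measure, \<open>chain_step p\<close> fixes
  \<open>\<nu>\<close>, and invariance for all bounded measurable functions follows.\<close>

lemma limit_measure_invariant:
  assumes \<nu>: "borel_prob_on_simplex \<nu>"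
    and rate: "\<And>L (f :: real ^ 'd \<Rightarrow> complex) x n. 0 \<le> L \<Longrightarrow> lipschitz_wrt_trunc \<alpha> K L f \<Longrightarrow> x \<in> std_simplex \<Longrightarrow>
       norm ((transition_op p ^^ n) f x - (LINT y|\<nu>. f y)) \<le> \<rho> ^ n * L"
  shows "invariant_measure p \<nu>"
proof -
  have "chain_step p \<nu> = \<nu>"
  proof (rule measure_eqI_lipschitz[OF \<alpha> K chain_step_prob[OF weights \<nu>] \<nu>])
    fix L and f :: "real ^ 'd \<Rightarrow> complex" assume L: "0 \<le> L" "lipschitz_wrt_trunc \<alpha> K L f"
    let ?f = "\<lambda>n. (transition_op p ^^ n) f (vertex None)"
    have L': "0 \<le> \<rho> * L" using L \<rho> by simp
    have "(\<lambda>n. (transition_op p ^^ n) (transition_op p f) (vertex None))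
        \<longlonglongrightarrow> (LINT y|\<nu>. transition_op p f y)"
      by (rule rate_imp_limit[OF rate[OF L' contracts[OF L] vertex_in_simplex]])
    then have "(\<lambda>n. ?f (Suc n)) \<longlonglongrightarrow> (LINT y|\<nu>. transition_op p f y)"
      by (simp add: funpow_swap1)
    moreover have "(\<lambda>n. ?f (Suc n)) \<longlonglongrightarrow> (LINT y|\<nu>. f y)"
      by (rule LIMSEQ_Suc[OF rate_imp_limit[OF rate[OF L vertex_in_simplex]]])
    ultimately have "(LINT y|\<nu>. transition_op p f y) = (LINT y|\<nu>. f y)" by (rule LIMSEQ_unique)
    then show "(LINT x|chain_step p \<nu>. f x) = (LINT x|\<nu>. f x)"
      using integral_chain_step[OF weights \<nu>] lipschitz_test_function(2,3)[OF L] by simp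
  qed
  then show ?thesis
    unfolding invariant_measure_def using integral_chain_step[OF weights \<nu>] by simp
qed

end

theorem theorem11:
  fixes p :: "'d::finite option \<Rightarrow> real ^ 'd \<Rightarrow> real" and \<alpha> :: real
  assumes "CARD('d) \<ge> 2"
    and "0 < \<alpha>" and "\<alpha> \<le> 1"
    and "weight_functions p"
    and "\<forall>j. holder_on \<alpha> std_simplex (p j)"
    and "\<exists>i. (INF x\<in>std_simplex. p i x) > 0"
  shows "\<exists>\<nu>. borel_prob_on_simplex \<nu> \<and> invariant_measure p \<nu> \<and>
    (\<forall>\<nu>'. borel_prob_on_simplex \<nu>' \<and> invariant_measure p \<nu>' \<longrightarrow> \<nu>' = \<nu>) \<and>
    (\<exists>\<kappa> > 0. \<exists>\<rho>. 0 < \<rho> \<and> \<rho> < 1 \<and>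
      (\<forall>\<phi> :: real ^ 'd \<Rightarrow> complex. holder_on \<alpha> std_simplex \<phi> \<longrightarrow>
        (\<forall>x\<in>std_simplex. \<forall>n::nat.
          norm ((transition_op p ^^ n) \<phi> x - (LINT y|\<nu>. \<phi> y))
            \<le> \<kappa> * \<rho> ^ n * holder_norm \<alpha> std_simplex \<phi>)))"
proof -
  obtain K \<rho> where K: "1 \<le> K" and \<rho>: "0 < \<rho>" "\<rho> < 1"
    and contracts: "\<And>L f. 0 \<le> L \<Longrightarrow> lipschitz_wrt_trunc \<alpha> K L f \<Longrightarrow>
       lipschitz_wrt_trunc \<alpha> K (\<rho> * L) (transition_op p f)"
    by (rule transition_op_contracts[OF assms(2) assms(4-6)], rule that)
  interpret contracting_chain p \<alpha> K \<rho>
    by unfold_locales (use assms K \<rho> contracts in auto)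
  obtain \<nu> where \<nu>: "borel_prob_on_simplex \<nu>"
    and rate: "\<And>L (f :: real ^ 'd \<Rightarrow> complex) x n. 0 \<le> L \<Longrightarrow> lipschitz_wrt_trunc \<alpha> K L f \<Longrightarrow> x \<in> std_simplex \<Longrightarrow>
       norm ((transition_op p ^^ n) f x - (LINT y|\<nu>. f y)) \<le> \<rho> ^ n * L"
    by (rule limit_measure_exists) (rule that)
  have inv: "invariant_measure p \<nu>" by (rule limit_measure_invariant[OF \<nu> rate])
  have unique: "\<nu>' = \<nu>" if "borel_prob_on_simplex \<nu>' \<and> invariant_measure p \<nu>'" for \<nu>'
    using that by (intro invariant_measure_unique \<nu> inv) auto
  have "norm ((transition_op p ^^ n) \<phi> x - (LINT y|\<nu>. \<phi> y))
      \<le> 2 * \<rho> ^ n * holder_norm \<alpha> std_simplex \<phi>"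
    if "holder_on \<alpha> std_simplex \<phi>" "x \<in> std_simplex" for \<phi> :: "real ^ 'd \<Rightarrow> complex" and x n
    using rate[OF _ holder_norm_bound(2)[OF \<alpha>(1) K(1) that(1)] that(2), of n]
      holder_norm_bound(1)[OF \<alpha>(1) K(1) that(1)] by (simp add: mult_ac)
  then have "\<exists>\<kappa> > 0. \<exists>\<rho>. 0 < \<rho> \<and> \<rho> < 1 \<and>
      (\<forall>\<phi> :: real ^ 'd \<Rightarrow> complex. holder_on \<alpha> std_simplex \<phi> \<longrightarrow>
        (\<forall>x\<in>std_simplex. \<forall>n::nat.
          norm ((transition_op p ^^ n) \<phi> x - (LINT y|\<nu>. \<phi> y))
            \<le> \<kappa> * \<rho> ^ n * holder_norm \<alpha> std_simplex \<phi>))"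
    using \<rho> by (intro exI[of _ "2 :: real"] exI[of _ \<rho>] conjI allI impI ballI) auto
  then show ?thesis using \<nu> inv unique by blast
qed

end
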